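(* Let $1\le p<\infty$, let $X,Y$ be complex Banach spaces, and suppose that $f:[0,\infty)\times Y\to X$ is an asymptotically $S^p$-almost periodic function. Then there are two functions $g:\mathbb{R}\times Y\to X$ and $q:[0,\infty)\times Y\to X$ such that for each $y\in Y$ the functions $g(\cdot,y)$ and $q(\cdot,y)$ are locally $p$-integrable, and such that the following holds: (i) $\hat g:\mathbb{R}\times Y\to L^p([0,1]:X)$ is almost periodic; (ii) $\hat q\in C_0([0,\infty)\times Y:L^p([0,1]:X))$; (iii) $f(t,y)=g(t,y)+q(t,y)$ for all $t\ge 0$ and $y\in Y$. Moreover, for every compact set $K\subseteq Y$ there exists an increasing sequence $(t_n)_{n\in\mathbb{N}}$ of positive reals such that $\lim_{n\to\infty}t_n=\infty$ and, for every $y\in K$, $g(t,y)=\lim_{n\to\infty}f(t+t_n,y)$ for a.e. $t\ge 0$.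
   Context: Let $I=\mathbb{R}$ or $I=[0,\infty)$, and let $Z$ be a Banach space. For $f:I\times Y\to X$ with $f(\cdot,y)$ locally $p$-integrable for each $y$, define $\hat f:I\times Y\to L^p([0,1]:X)$ by $\hat f(t,y):=f(t+\cdot,y)$. A function $F:I\times Y\to Z$ is almost periodic, $F\in AP(I\times Y:Z)$, if $F$ is bounded, continuous, and for every $\epsilon>0$ and every compact $K\subseteq Y$ there exists $l(\epsilon,K)>0$ such that every subinterval $J\subseteq I$ of length $l(\epsilon,K)$ contains a number $\tau$ with $\|F(t+\tau,y)-F(t,y)\|\le\epsilon$ for all $t\in I$, $y\in K$. $C_0([0,\infty)\times Y:Z)$ is the space of continuous functions $h:[0,\infty)\times Y\to Z$ such that $\lim_{t\to\infty}h(t,y)=0$ uniformly for $y$ in any compact subset of $Y$. A function $F:[0,\infty)\times Y\to Z$ is asymptotically almost periodic if it is bounded, continuous and $F=G+Q$ with $G\in AP([0,\infty)\times Y:Z)$ and $Q\in C_0([0,\infty)\times Y:Z)$. A function $f:[0,\infty)\times Y\to X$ is asymptotically $S^p$-almost periodic if $\hat f:[0,\infty)\times Y\to L^p([0,1]:X)$ is asymptotically almost periodic. *)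

theory Defs
  imports "HOL-Analysis.Analysis"
begin

class complex_banach = banach +
  fixes scaleC :: "complex \<Rightarrow> 'a \<Rightarrow> 'a"
  assumes scaleC_add_right: "scaleC c (x + y) = scaleC c x + scaleC c y"
    and scaleC_add_left: "scaleC (c + d) x = scaleC c x + scaleC d x"
    and scaleC_scaleC: "scaleC c (scaleC d x) = scaleC (c * d) x"
    and scaleC_of_real: "scaleC (complex_of_real r) x = scaleR r x"
    and norm_scaleC: "norm (scaleC c x) = cmod c * norm x"

instantiation complex :: complex_banach
begin

definition scaleC_complex :: "complex \<Rightarrow> complex \<Rightarrow> complex" where
  "scaleC_complex c x = c * x"

instance
  by standard (simp_all add: scaleC_complex_def algebra_simps scaleR_conv_of_real norm_mult)

end

text \<open>
  The value space may be non-separable, so plain Borel measurability is not enough; measurability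
  is meant in the sense of Bochner.
\<close>

definition strongly_measurable :: "'a measure \<Rightarrow> ('a \<Rightarrow> 'x::real_normed_vector) \<Rightarrow> bool" where
  "strongly_measurable M u \<longleftrightarrow>
     (\<exists>s. (\<forall>n. simple_function M (s n)) \<and> (AE x in M. (\<lambda>n::nat. s n x) \<longlonglongrightarrow> u x))"

definition p_integrable_on :: "real \<Rightarrow> real set \<Rightarrow> (real \<Rightarrow> 'x::real_normed_vector) \<Rightarrow> bool" where
  "p_integrable_on p S u \<longleftrightarrow> strongly_measurable (lebesgue_on S) u \<and>
     (\<integral>\<^sup>+ t. ennreal (norm (u t) powr p) \<partial>lebesgue_on S) < \<infinity>"

definition locally_p_integrable_on :: "real \<Rightarrow> real set \<Rightarrow> (real \<Rightarrow> 'x::real_normed_vector) \<Rightarrow> bool" where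
  "locally_p_integrable_on p I u \<longleftrightarrow> (\<forall>a b. {a..b} \<subseteq> I \<longrightarrow> p_integrable_on p {a..b} u)"

text \<open>
  All functions \<open>[0,1] \<rightarrow> X\<close> modulo almost everywhere equality. This ambient vector space does not
  depend on \<open>p\<close>; the space \<open>L\<^sup>p([0,1]:X)\<close> is its subspace \<open>Lp p\<close>, with norm \<open>Lp_norm p\<close>.
\<close>

quotient_type 'x ae_fun =
  "real \<Rightarrow> 'x" / "\<lambda>u v. AE s in lebesgue_on {0..1::real}. u s = v s"
  morphisms rep_ae_fun ae_class
proof (rule equivpI)
  show "reflp (\<lambda>u v :: real \<Rightarrow> 'x. AE s in lebesgue_on {0..1::real}. u s = v s)"
    by (simp add: reflp_def)
  show "symp (\<lambda>u v :: real \<Rightarrow> 'x. AE s in lebesgue_on {0..1::real}. u s = v s)"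
    by (simp add: symp_def eq_commute)
  show "transp (\<lambda>u v :: real \<Rightarrow> 'x. AE s in lebesgue_on {0..1::real}. u s = v s)"
    by (rule transpI) (erule (1) AE_mp[OF _ AE_mp], simp)
qed

instantiation ae_fun :: (real_vector) real_vector
begin

lift_definition zero_ae_fun :: "'a ae_fun" is "\<lambda>_. 0" .

lift_definition plus_ae_fun :: "'a ae_fun \<Rightarrow> 'a ae_fun \<Rightarrow> 'a ae_fun"
  is "\<lambda>u v s. u s + v s"
  by (erule (1) AE_mp[OF _ AE_mp], simp)

lift_definition minus_ae_fun :: "'a ae_fun \<Rightarrow> 'a ae_fun \<Rightarrow> 'a ae_fun"
  is "\<lambda>u v s. u s - v s"
  by (erule (1) AE_mp[OF _ AE_mp], simp)

lift_definition uminus_ae_fun :: "'a ae_fun \<Rightarrow> 'a ae_fun"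
  is "\<lambda>u s. - u s"
  by simp

lift_definition scaleR_ae_fun :: "real \<Rightarrow> 'a ae_fun \<Rightarrow> 'a ae_fun"
  is "\<lambda>r u s. r *\<^sub>R u s"
  by (erule AE_mp, simp)

instance
  by standard (transfer; simp add: algebra_simps)+

end

definition Lp :: "real \<Rightarrow> 'x::real_normed_vector ae_fun set" where
  "Lp p = {ae_class u | u. p_integrable_on p {0..1} u}"

lift_definition Lp_norm :: "real \<Rightarrow> 'x::real_normed_vector ae_fun \<Rightarrow> real"
  is "\<lambda>p u. enn2real (\<integral>\<^sup>+ s. ennreal (norm (u s) powr p) \<partial>lebesgue_on {0..1}) powr (1 / p)"
  by (rule arg_cong[where f = "\<lambda>x. enn2real x powr _"], rule nn_integral_cong_AE, erule AE_mp, simp)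

text \<open>
  A normed space is given by a carrier \<open>Z\<close>, a subspace of an ambient real vector space, together
  with a norm \<open>N\<close> on it. Functions on \<open>I \<times> Y\<close> are curried and total in the time variable; only
  their values at times in \<open>I\<close> matter.
\<close>

definition maps_continuously ::
  "'z::real_vector set \<Rightarrow> ('z \<Rightarrow> real) \<Rightarrow> real set \<Rightarrow> (real \<Rightarrow> 'y::metric_space \<Rightarrow> 'z) \<Rightarrow> bool" where
  "maps_continuously Z N I F \<longleftrightarrow>
     (\<forall>t\<in>I. \<forall>y. F t y \<in> Z) \<and>
     (\<forall>t\<in>I. \<forall>y. \<forall>\<epsilon>>0. \<exists>\<delta>>0. \<forall>s\<in>I. \<forall>z. dist (s, z) (t, y) < \<delta> \<longrightarrow> N (F s z - F t y) < \<epsilon>)"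

definition norm_bounded ::
  "('z \<Rightarrow> real) \<Rightarrow> real set \<Rightarrow> (real \<Rightarrow> 'y \<Rightarrow> 'z) \<Rightarrow> bool" where
  "norm_bounded N I F \<longleftrightarrow> (\<exists>C. \<forall>t\<in>I. \<forall>y. N (F t y) \<le> C)"

definition almost_periodic ::
  "'z::real_vector set \<Rightarrow> ('z \<Rightarrow> real) \<Rightarrow> real set \<Rightarrow> (real \<Rightarrow> 'y::metric_space \<Rightarrow> 'z) \<Rightarrow> bool" where
  "almost_periodic Z N I F \<longleftrightarrow>
     norm_bounded N I F \<and> maps_continuously Z N I F \<and>
     (\<forall>\<epsilon>>0. \<forall>K. compact K \<longrightarrow>
        (\<exists>l>0. \<forall>a. {a..a + l} \<subseteq> I \<longrightarrow>
           (\<exists>\<tau>\<in>{a..a + l}. \<forall>t\<in>I. \<forall>y\<in>K. N (F (t + \<tau>) y - F t y) \<le> \<epsilon>)))"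

definition C0_halfline ::
  "'z::real_vector set \<Rightarrow> ('z \<Rightarrow> real) \<Rightarrow> (real \<Rightarrow> 'y::metric_space \<Rightarrow> 'z) set" where
  "C0_halfline Z N = {h. maps_continuously Z N {0..} h \<and>
     (\<forall>K. compact K \<longrightarrow> uniform_limit K (\<lambda>t y. N (h t y)) (\<lambda>_. 0) at_top)}"

definition asymptotically_almost_periodic ::
  "'z::real_vector set \<Rightarrow> ('z \<Rightarrow> real) \<Rightarrow> (real \<Rightarrow> 'y::metric_space \<Rightarrow> 'z) \<Rightarrow> bool" where
  "asymptotically_almost_periodic Z N F \<longleftrightarrow>
     norm_bounded N {0..} F \<and> maps_continuously Z N {0..} F \<and>
     (\<exists>G Q. almost_periodic Z N {0..} G \<and> Q \<in> C0_halfline Z N \<and>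
        (\<forall>t\<ge>0. \<forall>y. F t y = G t y + Q t y))"

definition bochner_transform :: "(real \<Rightarrow> 'y \<Rightarrow> 'x) \<Rightarrow> real \<Rightarrow> 'y \<Rightarrow> 'x ae_fun" where
  "bochner_transform f t y = ae_class (\<lambda>s. f (t + s) y)"

definition asymptotically_Sp_almost_periodic ::
  "real \<Rightarrow> (real \<Rightarrow> 'y::metric_space \<Rightarrow> 'x::real_normed_vector) \<Rightarrow> bool" where
  "asymptotically_Sp_almost_periodic p f \<longleftrightarrow>
     (\<forall>y. locally_p_integrable_on p {0..} (\<lambda>t. f t y)) \<and>
     asymptotically_almost_periodic (Lp p) (Lp_norm p) (bochner_transform f)"

end

theory Submission
  imports Defs
begin

text \<open>
  Write \<open>f\<close> and its decomposition \<open>G + Q\<close> on the level of Bochner transforms. For fixed \<open>y\<close> there are almost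
  periods \<open>\<tau>\<^sub>n \<rightarrow> \<infinity>\<close> of \<open>G(\<cdot>, y)\<close> for the precision \<open>4\<^sup>-\<^sup>n\<close>, so far out that \<open>Q\<close> is smaller than \<open>4\<^sup>-\<^sup>n\<close> beyond
  \<open>\<tau>\<^sub>n - n\<close>. The translates of \<open>f\<close> by \<open>\<tau>\<^sub>n\<close> then form a rapidly converging Cauchy sequence in \<open>L\<^sup>p\<close> on every unit
  interval of the real line, hence converge there almost everywhere and in \<open>L\<^sup>p\<close>; their limit is \<open>g\<close>. Since
  \<open>G(t + \<tau>\<^sub>n, y)\<close> tends to the transform of \<open>g\<close>, that transform extends \<open>G\<close> to the real line and inherits its
  almost periods, and \<open>q = f - g\<close> has transform \<open>Q\<close>. Repeating the choice of almost periods uniformly over a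
  compact set \<open>K\<close> gives a sequence along which the translates of \<open>f\<close> converge in \<open>L\<^sup>p\<close> at a geometric rate
  for each \<open>y \<in> K\<close>, and therefore almost everywhere.
\<close>

section \<open>Strong measurability\<close>

lemma strongly_measurable_cong_AE:
  assumes "AE x in M. u x = v x" "strongly_measurable M u"
  shows "strongly_measurable M v"
proof -
  obtain s where s: "\<And>n. simple_function M (s n)" "AE x in M. (\<lambda>n::nat. s n x) \<longlonglongrightarrow> u x"
    using assms(2) unfolding strongly_measurable_def by blast
  have "AE x in M. (\<lambda>n. s n x) \<longlonglongrightarrow> v x"
    using assms(1) s(2) by eventually_elim simp
  with s(1) show ?thesis
    unfolding strongly_measurable_def by blast
qed

lemma strongly_measurable_add:
  assumes "strongly_measurable M u" "strongly_measurable M v"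
  shows "strongly_measurable M (\<lambda>x. u x + v x)"
proof -
  obtain s where s: "\<And>n. simple_function M (s n)" "AE x in M. (\<lambda>n::nat. s n x) \<longlonglongrightarrow> u x"
    using assms(1) unfolding strongly_measurable_def by blast
  obtain r where r: "\<And>n. simple_function M (r n)" "AE x in M. (\<lambda>n::nat. r n x) \<longlonglongrightarrow> v x"
    using assms(2) unfolding strongly_measurable_def by blast
  have "AE x in M. (\<lambda>n. s n x + r n x) \<longlonglongrightarrow> u x + v x"
    using s(2) r(2) by eventually_elim (rule tendsto_add)
  moreover have "simple_function M (\<lambda>x. s n x + r n x)" for n
    using s(1) r(1) by (rule simple_function_compose2)
  ultimately show ?thesis
    unfolding strongly_measurable_def by (intro exI[of _ "\<lambda>n x. s n x + r n x"]) blast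
qed

lemma strongly_measurable_scaleR:
  assumes "simple_function M c" "strongly_measurable M u"
  shows "strongly_measurable M (\<lambda>x. c x *\<^sub>R u x)"
proof -
  obtain s where s: "\<And>n. simple_function M (s n)" "AE x in M. (\<lambda>n::nat. s n x) \<longlonglongrightarrow> u x"
    using assms(2) unfolding strongly_measurable_def by blast
  have "AE x in M. (\<lambda>n. c x *\<^sub>R s n x) \<longlonglongrightarrow> c x *\<^sub>R u x"
    using s(2) by eventually_elim (intro tendsto_intros)
  moreover have "simple_function M (\<lambda>x. c x *\<^sub>R s n x)" for n
    using assms(1) s(1) by (rule simple_function_compose2)
  ultimately show ?thesis
    unfolding strongly_measurable_def by (intro exI[of _ "\<lambda>n x. c x *\<^sub>R s n x"]) blast
qed

lemma strongly_measurable_diff: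
  assumes "strongly_measurable M u" "strongly_measurable M v"
  shows "strongly_measurable M (\<lambda>x. u x - v x)"
  using strongly_measurable_add[OF assms(1) strongly_measurable_scaleR[OF _ assms(2), of "\<lambda>_. -1"]]
  by simp

text \<open>Strong measurability fixes \<open>u\<close> only up to a null set, so
  \<open>norm (u x)\<close> itself need not be Borel measurable when \<open>M\<close> is incomplete.
  The limit of the norms of the simple functions is a measurable stand-in wherever an integral
  theorem asks for one.\<close>

lemma strongly_measurable_norm:
  assumes "strongly_measurable M u"
  obtains h :: "'a \<Rightarrow> real"
  where "h \<in> borel_measurable M" "AE x in M. norm (u x) = h x"
proof -
  obtain s where s: "\<And>n. simple_function M (s n)" "AE x in M. (\<lambda>n::nat. s n x) \<longlonglongrightarrow> u x"
    using assms unfolding strongly_measurable_def by blast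
  have "(\<lambda>x. norm (s n x)) \<in> borel_measurable M" for n
    by (rule borel_measurable_simple_function[OF simple_function_compose1[OF s(1)]])
  then have "(\<lambda>x. lim (\<lambda>n. norm (s n x))) \<in> borel_measurable M"
    by (rule borel_measurable_lim_metric)
  moreover have "AE x in M. norm (u x) = lim (\<lambda>n. norm (s n x))"
    using s(2) by eventually_elim (rule limI[OF tendsto_norm, symmetric])
  ultimately show ?thesis ..
qed

text \<open>Extension by zero puts functions on different sets into a single measure space, where
  they can be cut off by indicators and added.\<close>

lemma strongly_measurable_restrict_iff:
  assumes "S \<in> sets lebesgue"
  shows "strongly_measurable (lebesgue_on S) u \<longleftrightarrow> strongly_measurable lebesgue (\<lambda>x. indicator S x *\<^sub>R u x)"
    (is "?L \<longleftrightarrow> ?R")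
proof
  have S: "S \<inter> space lebesgue \<in> sets lebesgue"
    using assms by simp
  { assume ?L
    then obtain s where s: "\<And>n. simple_function (lebesgue_on S) (s n)"
        "AE x in lebesgue_on S. (\<lambda>n::nat. s n x) \<longlonglongrightarrow> u x"
      unfolding strongly_measurable_def by blast
    have "AE x in lebesgue. (\<lambda>n. indicator S x *\<^sub>R s n x) \<longlonglongrightarrow> indicator S x *\<^sub>R u x"
      using s(2) unfolding AE_restrict_space_iff[OF S]
      by eventually_elim (auto split: split_indicator)
    with s(1) show ?R
      unfolding strongly_measurable_def simple_function_restrict_space[OF S]
      by (intro exI[of _ "\<lambda>n x. indicator S x *\<^sub>R s n x"]) blast }
  { assume ?R
    then obtain s where s: "\<And>n. simple_function lebesgue (s n)"
        "AE x in lebesgue. (\<lambda>n::nat. s n x) \<longlonglongrightarrow> indicator S x *\<^sub>R u x"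
      unfolding strongly_measurable_def by blast
    have "simple_function (lebesgue_on S) (s n)" for n
      unfolding simple_function_restrict_space[OF S]
      using assms s(1) by (intro simple_function_compose2[where h = "(*\<^sub>R)"] simple_function_indicator)
    moreover have "AE x in lebesgue_on S. (\<lambda>n. s n x) \<longlonglongrightarrow> u x"
      using s(2) unfolding AE_restrict_space_iff[OF S]
      by eventually_elim auto
    ultimately show ?L
      unfolding strongly_measurable_def by blast }
qed

lemma strongly_measurable_comp:
  assumes T: "T \<in> measurable M N" "distr M N T = N" and u: "strongly_measurable N u"
  shows "strongly_measurable M (\<lambda>x. u (T x))"
proof -
  obtain s where s: "\<And>n. simple_function N (s n)" "AE x in N. (\<lambda>n::nat. s n x) \<longlonglongrightarrow> u x"
    using u unfolding strongly_measurable_def by blast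
  have "AE x in M. (\<lambda>n. s n (T x)) \<longlonglongrightarrow> u (T x)"
    using s(2) by (intro AE_distrD[OF T(1)]) (simp only: T(2))
  moreover have "simple_function M (\<lambda>x. s n (T x))" for n
    using T(1) s(1) by (rule simple_function_comp)
  ultimately show ?thesis
    unfolding strongly_measurable_def by (intro exI[of _ "\<lambda>n x. s n (T x)"]) blast
qed

text \<open>Each \<open>u n\<close> is replaced by a simple function that is uniformly close to it off a set of measure
  at most \<open>2\<^sup>-\<^sup>n\<close>; the Borel--Cantelli lemma then turns these into a sequence converging almost everywhere.\<close>

lemma (in finite_measure) strongly_measurable_LIMSEQ:
  fixes u :: "nat \<Rightarrow> 'a \<Rightarrow> 'x::real_normed_vector"
  assumes u: "\<And>n. strongly_measurable M (u n)" and lim: "AE x in M. (\<lambda>n. u n x) \<longlonglongrightarrow> v x"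
  shows "strongly_measurable M v"
proof -
  obtain s where s: "\<And>n k. simple_function M (s n k)"
      "\<And>n. AE x in M. (\<lambda>k::nat. s n k x) \<longlonglongrightarrow> u n x"
    using choice[of "\<lambda>n s. (\<forall>k. simple_function M (s k)) \<and> (AE x in M. (\<lambda>k::nat. s k x) \<longlonglongrightarrow> u n x)"]
      u[unfolded strongly_measurable_def] by blast
  \<comment> \<open>\<open>A n k\<close> collects the points where \<open>s n k\<close> is farther
    than \<open>(1/2)^n\<close> from some later term; it need not decrease in \<open>k\<close>. The
    larger set \<open>B n k\<close>, which compares any two later terms, decreases to a null set
    because convergent sequences are Cauchy, so continuity from above applies to it.\<close>
  define A where "A n k = {x \<in> space M. \<exists>j\<ge>k. \<not> dist (s n j x) (s n k x) \<le> (1/2)^n}" for n k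
  define B where "B n k = {x \<in> space M. \<exists>j\<ge>k. \<exists>i\<ge>k. \<not> dist (s n j x) (s n i x) \<le> (1/2)^n}" for n k
  have meas: "(\<lambda>x. dist (s n j x) (s n i x)) \<in> borel_measurable M" for n j i
    by (rule borel_measurable_simple_function[OF simple_function_compose2[OF s(1) s(1)]])
  have A[measurable]: "A n k \<in> sets M" and B[measurable]: "B n k \<in> sets M" for n k
    unfolding A_def B_def using meas by measurable
  have AB: "A n k \<subseteq> B n k" for n k
    unfolding A_def B_def by blast
  have "(\<lambda>k. measure M (B n k)) \<longlonglongrightarrow> measure M (\<Inter>k. B n k)" for n
  proof (rule finite_Lim_measure_decseq)
    show "decseq (B n)"
      unfolding B_def by (rule decseq_SucI) (use Suc_leD in blast)
  qed (use B in auto)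
  moreover have "measure M (\<Inter>k. B n k) = 0" for n
  proof -
    have "AE x in M. x \<notin> (\<Inter>k. B n k)"
      using s(2)[of n]
    proof eventually_elim
      case (elim x)
      then have "Cauchy (\<lambda>k. s n k x)"
        by (rule LIMSEQ_imp_Cauchy)
      then obtain k where "\<And>j i. j \<ge> k \<Longrightarrow> i \<ge> k \<Longrightarrow> dist (s n j x) (s n i x) < (1/2)^n"
        using metric_CauchyD[of _ "(1/2)^n"] by (metis half_gt_zero_iff zero_less_one zero_less_power)
      then have "x \<notin> B n k"
        unfolding B_def by (auto simp: less_imp_le)
      then show ?case by blast
    qed
    then have "(\<Inter>k. B n k) \<in> null_sets M"
      using B by (subst AE_iff_null_sets) auto
    then show ?thesis
      by (simp add: measure_eq_0_null_sets)
  qed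
  ultimately have "\<exists>k. measure M (B n k) < (1/2)^n" for n
    using order_tendstoD(2)[of "\<lambda>k. measure M (B n k)" 0 sequentially "(1/2)^n"]
    by (auto simp: eventually_sequentially)
  then obtain k where k: "\<And>n. measure M (B n (k n)) < (1/2)^n"
    by metis
  have "AE x in M. eventually (\<lambda>n. x \<in> space M - A n (k n)) sequentially"
  proof (rule borel_cantelli_AE1)
    have "measure M (A n (k n)) \<le> (1/2)^n" for n
      using finite_measure_mono[OF AB B] k[of n] by (meson less_imp_le order_trans)
    then show "summable (\<lambda>n. measure M (A n (k n)))"
      by (intro summable_comparison_test[OF _ summable_geometric[of "1/2::real"]])
         (auto intro!: exI[of _ 0])
  qed (use A emeasure_finite in \<open>auto simp: less_top[symmetric]\<close>)
  moreover have "AE x in M. \<forall>n. (\<lambda>k. s n k x) \<longlonglongrightarrow> u n x"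
    using s(2) by (simp add: AE_all_countable)
  ultimately have "AE x in M. (\<lambda>n. s n (k n) x) \<longlonglongrightarrow> v x"
    using lim
  proof eventually_elim
    case (elim x)
    have "dist (u n x) (s n (k n) x) \<le> (1/2)^n" if "x \<in> space M - A n (k n)" for n
    proof (rule LIMSEQ_le_const2)
      show "(\<lambda>j. dist (s n j x) (s n (k n) x)) \<longlonglongrightarrow> dist (u n x) (s n (k n) x)"
        using elim(2) by (intro tendsto_intros) auto
      show "\<exists>N. \<forall>j\<ge>N. dist (s n j x) (s n (k n) x) \<le> (1/2)^n"
        using that unfolding A_def by blast
    qed
    then have "eventually (\<lambda>n. norm (s n (k n) x - u n x) \<le> (1/2)^n) sequentially"
      using elim(1) by (auto elim!: eventually_mono simp: dist_norm norm_minus_commute)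
    then have "(\<lambda>n. s n (k n) x - u n x) \<longlonglongrightarrow> 0"
      by (rule Lim_null_comparison) (simp add: LIMSEQ_power_zero)
    from tendsto_add[OF this elim(3)] show ?case by simp
  qed
  with s(1) show ?thesis
    unfolding strongly_measurable_def by (intro exI[of _ "\<lambda>n. s n (k n)"]) blast
qed

section \<open>The spaces \<open>L\<^sup>p\<close>\<close>

text \<open>For positive arguments this is convexity of the power function. If one argument
  vanishes, it reduces to the fact that a weight strictly between \<open>0\<close> and
  \<open>1\<close> dominates its own \<open>p\<close>-th power.\<close>

lemma powr_convex_combination_le:
  fixes p :: real
  assumes "1 \<le> p" "0 < l" "l < 1" "0 \<le> x" "0 \<le> y"
  shows "(l * x + (1 - l) * y) powr p \<le> l * x powr p + (1 - l) * y powr p"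
proof -
  have *: "(k * z) powr p \<le> k * z powr p" if "0 < k" "k < 1" "0 \<le> z" for k z :: real
  proof -
    have "k powr p \<le> k powr 1"
      using that assms(1) by (intro powr_mono') auto
    then show ?thesis
      using that by (simp add: powr_mult mult_right_mono)
  qed
  consider "x = 0" | "y = 0" | "0 < x" "0 < y"
    using assms(4,5) by fastforce
  then show ?thesis
  proof cases
    case 1
    then show ?thesis using *[of "1 - l" y] assms by simp
  next
    case 2
    then show ?thesis using *[of l x] assms by simp
  next
    case 3
    have "((1 - (1 - l)) *\<^sub>R x + (1 - l) *\<^sub>R y) powr p
        \<le> (1 - (1 - l)) * x powr p + (1 - l) * y powr p"
      by (rule convex_onD[OF powr_convex[OF assms(1)]]) (use 3 assms in auto)
    then show ?thesis by simp
  qed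
qed

abbreviation Lp_integral :: "real \<Rightarrow> 'a measure \<Rightarrow> ('a \<Rightarrow> 'x::real_normed_vector) \<Rightarrow> ennreal" where
  "Lp_integral p M u \<equiv> (\<integral>\<^sup>+ x. ennreal (norm (u x) powr p) \<partial>M)"

lemma Lp_integral_cong_AE:
  "AE x in M. norm (u x) = norm (v x) \<Longrightarrow> Lp_integral p M u = Lp_integral p M v"
  by (rule nn_integral_cong_AE) (auto elim!: eventually_mono)

text \<open>Minkowski's inequality, without roots: the convexity of \<open>x powr p\<close> is applied with weights
  proportional to \<open>A\<close> and \<open>B\<close>.\<close>

lemma Lp_integral_add_le:
  fixes A B p :: real
  assumes p: "1 \<le> p" and AB: "0 < A" "0 < B"
    and u: "strongly_measurable M u" "Lp_integral p M u \<le> ennreal (A powr p)"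
    and v: "strongly_measurable M v" "Lp_integral p M v \<le> ennreal (B powr p)"
  shows "Lp_integral p M (\<lambda>x. u x + v x) \<le> ennreal ((A + B) powr p)"
proof -
  obtain h where h[measurable]: "h \<in> borel_measurable M" and hu: "AE x in M. norm (u x) = h x"
    using strongly_measurable_norm[OF u(1)] .
  obtain k where k[measurable]: "k \<in> borel_measurable M" and kv: "AE x in M. norm (v x) = k x"
    using strongly_measurable_norm[OF v(1)] .
  define l where "l = A / (A + B)"
  have l: "0 < l" "l < 1" "1 - l = B / (A + B)"
    using AB by (auto simp: l_def field_simps)
  \<comment> \<open>Rescaling the arguments by \<open>(A + B) / A\<close> and
    \<open>(A + B) / B\<close> turns both bounds \<open>A powr p\<close> and \<open>B powr p\<close>
    into \<open>(A + B) powr p\<close>, and the weights \<open>l\<close> and \<open>1 - l\<close>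
    then add up to one.\<close>
  define a where "a = l * ((A + B) / A) powr p"
  define b where "b = (1 - l) * ((A + B) / B) powr p"
  have ab: "0 \<le> a" "0 \<le> b"
    using l(1,2) by (simp_all add: a_def b_def)
  have le: "(x + y) powr p \<le> a * x powr p + b * y powr p" if "0 \<le> x" "0 \<le> y" for x y
  proof -
    have "x + y = l * ((A + B) / A * x) + (1 - l) * ((A + B) / B * y)"
      unfolding l(3) using AB by (simp add: l_def)
    then have "(x + y) powr p
        \<le> l * ((A + B) / A * x) powr p + (1 - l) * ((A + B) / B * y) powr p"
      using powr_convex_combination_le[OF p l(1,2), of "(A + B) / A * x" "(A + B) / B * y"] that AB
      by simp
    also have "\<dots> = a * x powr p + b * y powr p"
      by (simp only: a_def b_def powr_mult mult.assoc)
    finally show ?thesis .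
  qed
  have eq: "a * A powr p + b * B powr p = (A + B) powr p"
  proof -
    have "a * A powr p + b * B powr p
        = l * ((A + B) / A * A) powr p + (1 - l) * ((A + B) / B * B) powr p"
      using AB by (simp only: a_def b_def powr_mult mult.assoc)
    also have "\<dots> = (A + B) powr p"
      using AB by (simp add: left_diff_distrib)
    finally show ?thesis .
  qed
  have int_u: "(\<integral>\<^sup>+ x. ennreal (h x powr p) \<partial>M) = Lp_integral p M u"
    by (rule nn_integral_cong_AE) (use hu in \<open>auto elim!: eventually_mono\<close>)
  have int_v: "(\<integral>\<^sup>+ x. ennreal (k x powr p) \<partial>M) = Lp_integral p M v"
    by (rule nn_integral_cong_AE) (use kv in \<open>auto elim!: eventually_mono\<close>)
  have "Lp_integral p M (\<lambda>x. u x + v x)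
      \<le> (\<integral>\<^sup>+ x. ennreal a * ennreal (h x powr p) + ennreal b * ennreal (k x powr p) \<partial>M)"
  proof (rule nn_integral_mono_AE)
    show "AE x in M. ennreal (norm (u x + v x) powr p)
        \<le> ennreal a * ennreal (h x powr p) + ennreal b * ennreal (k x powr p)"
      using hu kv
    proof eventually_elim
      case (elim x)
      have "norm (u x + v x) powr p \<le> (norm (u x) + norm (v x)) powr p"
        using p by (intro powr_mono2 norm_triangle_ineq) auto
      also have "\<dots> \<le> a * h x powr p + b * k x powr p"
        using le[OF norm_ge_zero norm_ge_zero, of "u x" "v x"] elim by simp
      finally show ?case
        using ab by (simp flip: ennreal_mult' ennreal_plus)
    qed
  qed
  also have "\<dots> = ennreal a * Lp_integral p M u + ennreal b * Lp_integral p M v"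
    by (simp add: nn_integral_add nn_integral_cmult int_u int_v)
  also have "\<dots> \<le> ennreal a * ennreal (A powr p) + ennreal b * ennreal (B powr p)"
    using u(2) v(2) by (intro add_mono mult_left_mono) auto
  also have "\<dots> = ennreal ((A + B) powr p)"
    using ab by (simp flip: ennreal_mult' ennreal_plus add: eq)
  finally show ?thesis .
qed

lemma Lp_integral_less_top_bound:
  assumes "1 \<le> p" "Lp_integral p M u < \<infinity>"
  obtains A where "0 < A" "Lp_integral p M u \<le> ennreal (A powr p)"
proof
  let ?I = "enn2real (Lp_integral p M u)"
  \<comment> \<open>The summand \<open>1\<close> keeps the bound positive even if the integral
    vanishes, since the weights in Minkowski's inequality divide by it.\<close>
  show "0 < (?I + 1) powr (1 / p)"
    by (simp add: add_nonneg_pos less_imp_neq[symmetric])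
  have "Lp_integral p M u = ennreal ?I"
    using assms(2) by (simp add: less_top)
  also have "\<dots> \<le> ennreal (((?I + 1) powr (1 / p)) powr p)"
    using assms(1) by (intro ennreal_leI) (simp add: powr_powr)
  finally show "Lp_integral p M u \<le> ennreal (((?I + 1) powr (1 / p)) powr p)" .
qed

lemma p_integrable_on_cong_AE:
  assumes "AE x in lebesgue_on S. u x = v x" "p_integrable_on p S u"
  shows "p_integrable_on p S v"
proof -
  have "Lp_integral p (lebesgue_on S) u = Lp_integral p (lebesgue_on S) v"
    using assms(1) by (intro Lp_integral_cong_AE) (auto elim!: eventually_mono)
  then show ?thesis
    using assms strongly_measurable_cong_AE unfolding p_integrable_on_def by auto
qed

lemma p_integrable_on_uminus:
  assumes "p_integrable_on p S u"
  shows "p_integrable_on p S (\<lambda>x. - u x)"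
  using assms strongly_measurable_scaleR[of "lebesgue_on S" "\<lambda>_. -1" u]
  by (simp add: p_integrable_on_def)

lemma p_integrable_on_add:
  assumes "1 \<le> p" "p_integrable_on p S u" "p_integrable_on p S v"
  shows "p_integrable_on p S (\<lambda>x. u x + v x)"
proof -
  note uv = assms(2,3)[unfolded p_integrable_on_def]
  obtain A where A: "0 < A" "Lp_integral p (lebesgue_on S) u \<le> ennreal (A powr p)"
    using Lp_integral_less_top_bound[OF assms(1) conjunct2[OF uv(1)]] .
  obtain B where B: "0 < B" "Lp_integral p (lebesgue_on S) v \<le> ennreal (B powr p)"
    using Lp_integral_less_top_bound[OF assms(1) conjunct2[OF uv(2)]] .
  have "Lp_integral p (lebesgue_on S) (\<lambda>x. u x + v x) \<le> ennreal ((A + B) powr p)"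
    using Lp_integral_add_le[OF assms(1)] A B uv by blast
  also have "\<dots> < \<infinity>" by simp
  finally show ?thesis
    using uv strongly_measurable_add unfolding p_integrable_on_def by blast
qed

lemma p_integrable_on_diff:
  assumes "1 \<le> p" "p_integrable_on p S u" "p_integrable_on p S v"
  shows "p_integrable_on p S (\<lambda>x. u x - v x)"
  using p_integrable_on_add[OF assms(1,2) p_integrable_on_uminus[OF assms(3)]] by simp

text \<open>\<open>Lp\<close> only asks for some integrable representative; integrability is
  invariant under almost everywhere equality, so any representative may be tested.\<close>

lemma ae_class_in_Lp_iff: "ae_class u \<in> Lp p \<longleftrightarrow> p_integrable_on p {0..1} u"
proof
  assume "ae_class u \<in> Lp p"
  then obtain v where "p_integrable_on p {0..1} v" "ae_class u = ae_class v"
    unfolding Lp_def by blast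
  then show "p_integrable_on p {0..1} u"
    using p_integrable_on_cong_AE[where u = v and v = u] by (simp add: ae_fun.abs_eq_iff eq_commute)
qed (auto simp: Lp_def)

lemma Lp_E:
  assumes "z \<in> Lp p"
  obtains u where "z = ae_class u" "p_integrable_on p {0..1} u"
  using assms unfolding Lp_def by blast

lemma Lp_add: "1 \<le> p \<Longrightarrow> z \<in> Lp p \<Longrightarrow> w \<in> Lp p \<Longrightarrow> z + w \<in> Lp p"
  by (auto elim!: Lp_E simp: plus_ae_fun.abs_eq ae_class_in_Lp_iff p_integrable_on_add)

lemma Lp_uminus: "z \<in> Lp p \<Longrightarrow> - z \<in> Lp p"
  by (auto elim!: Lp_E simp: uminus_ae_fun.abs_eq ae_class_in_Lp_iff p_integrable_on_uminus)

lemma Lp_norm_nonneg: "0 \<le> Lp_norm p z"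
  by transfer simp

lemma Lp_norm_uminus: "Lp_norm p (- z) = Lp_norm p z"
  by transfer simp

lemma Lp_norm_leI:
  assumes "1 \<le> p" "0 \<le> r" "Lp_integral p (lebesgue_on {0..1}) u \<le> ennreal (r powr p)"
  shows "Lp_norm p (ae_class u) \<le> r"
proof -
  have "enn2real (Lp_integral p (lebesgue_on {0..1}) u) \<le> r powr p"
    using assms(3) by (simp add: enn2real_leI)
  then have "enn2real (Lp_integral p (lebesgue_on {0..1}) u) powr (1 / p) \<le> (r powr p) powr (1 / p)"
    using assms(1) by (intro powr_mono2) auto
  also have "\<dots> = r"
    using assms(1,2) by (simp add: powr_powr)
  finally show ?thesis
    by (simp add: Lp_norm.abs_eq)
qed

text \<open>Integrability matters here: \<open>enn2real\<close> sends an infinite integral to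
  \<open>0\<close>, so a small value of \<open>Lp_norm\<close> alone bounds nothing.\<close>

lemma Lp_integral_le:
  assumes "1 \<le> p" "p_integrable_on p {0..1} u" "Lp_norm p (ae_class u) \<le> r"
  shows "Lp_integral p (lebesgue_on {0..1}) u \<le> ennreal (r powr p)"
proof -
  let ?I = "enn2real (Lp_integral p (lebesgue_on {0..1}) u)"
  have "Lp_integral p (lebesgue_on {0..1}) u = ennreal ?I"
    using assms(2) by (simp add: p_integrable_on_def less_top)
  also have "?I = (?I powr (1 / p)) powr p"
    using assms(1) by (simp add: powr_powr)
  also have "\<dots> \<le> r powr p"
    using assms(1,3) by (intro powr_mono2) (auto simp: Lp_norm.abs_eq)
  finally show ?thesis
    by (simp add: ennreal_leI)
qed

lemma Lp_norm_triangle: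
  assumes p: "1 \<le> p" and "z \<in> Lp p" "w \<in> Lp p"
  shows "Lp_norm p (z + w) \<le> Lp_norm p z + Lp_norm p w"
proof -
  obtain u where u: "z = ae_class u" "p_integrable_on p {0..1} u"
    using assms(2) by (rule Lp_E)
  obtain v where v: "w = ae_class v" "p_integrable_on p {0..1} v"
    using assms(3) by (rule Lp_E)
  \<comment> \<open>The slack \<open>e\<close> makes both bounds strictly positive, as
    \<open>Lp_integral_add_le\<close> demands, even when one of the norms is zero.\<close>
  have "Lp_norm p (z + w) \<le> Lp_norm p z + Lp_norm p w + e" if "0 < e" for e
  proof -
    have "Lp_integral p (lebesgue_on {0..1}) (\<lambda>x. u x + v x)
        \<le> ennreal (((Lp_norm p z + e/2) + (Lp_norm p w + e/2)) powr p)"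
    proof (rule Lp_integral_add_le[OF p])
      show "Lp_integral p (lebesgue_on {0..1}) u \<le> ennreal ((Lp_norm p z + e/2) powr p)"
           "Lp_integral p (lebesgue_on {0..1}) v \<le> ennreal ((Lp_norm p w + e/2) powr p)"
        using u v that by (auto intro!: Lp_integral_le[OF p])
    qed (use u v that Lp_norm_nonneg[of p z] Lp_norm_nonneg[of p w] in
        \<open>auto simp: p_integrable_on_def\<close>)
    then have "Lp_norm p (ae_class (\<lambda>x. u x + v x)) \<le> (Lp_norm p z + e/2) + (Lp_norm p w + e/2)"
      using that Lp_norm_nonneg[of p z] Lp_norm_nonneg[of p w] by (intro Lp_norm_leI[OF p]) auto
    then show ?thesis
      by (simp add: u v plus_ae_fun.abs_eq)
  qed
  then show ?thesis
    by (rule field_le_epsilon)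
qed

lemma Lp_norm_eq_0_imp:
  assumes "1 \<le> p" "z \<in> Lp p" "Lp_norm p z \<le> 0"
  shows "z = 0"
proof -
  obtain u where u: "z = ae_class u" "p_integrable_on p {0..1} u"
    using assms(2) by (rule Lp_E)
  obtain h where h[measurable]: "h \<in> borel_measurable (lebesgue_on {0..1})"
      and hu: "AE x in lebesgue_on {0..1}. norm (u x) = h x"
    using strongly_measurable_norm u(2) unfolding p_integrable_on_def by blast
  have "(\<integral>\<^sup>+ x. ennreal (h x powr p) \<partial>lebesgue_on {0..1}) = Lp_integral p (lebesgue_on {0..1}) u"
    by (rule nn_integral_cong_AE) (use hu in \<open>auto elim!: eventually_mono\<close>)
  also have "\<dots> \<le> ennreal (0 powr p)"
    using Lp_integral_le[OF assms(1) u(2)] assms(3) u(1) by blast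
  finally have "AE x in lebesgue_on {0..1}. ennreal (h x powr p) = 0"
    by (subst nn_integral_0_iff_AE[symmetric]) auto
  with hu have "AE x in lebesgue_on {0..1}. u x = 0"
    by eventually_elim (auto simp: ennreal_eq_0_iff)
  then show ?thesis
    by (simp add: u(1) zero_ae_fun_def ae_fun.abs_eq_iff)
qed

text \<open>The integrals of \<open>(2^n * norm (v n x)) powr p\<close> are dominated by a geometric
  series of ratio \<open>(1/2) powr p\<close>. Hence the sum over \<open>n\<close> has finite
  integral, is finite almost everywhere, and its terms tend to zero. The factor \<open>2^n\<close>
  spends only half of the decay \<open>(1/4)^n\<close>, so a summable pointwise rate is gained
  without passing to a subsequence.\<close>

lemma Lp_geometric_decay_tendsto_AE:
  fixes C p :: real
  assumes p: "1 \<le> p" and C: "0 \<le> C" and v: "\<And>n. strongly_measurable M (v n)"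
    and le: "\<And>n. Lp_integral p M (v n) \<le> ennreal ((C * (1/4)^n) powr p)"
  shows "AE x in M. (\<lambda>n. 2^n * norm (v n x)) \<longlonglongrightarrow> 0"
proof -
  have "\<exists>h. h \<in> borel_measurable M \<and> (AE x in M. norm (v n x) = h x)" for n
    using strongly_measurable_norm[OF v[of n]] by metis
  then obtain h where h[measurable]: "\<And>n. h n \<in> borel_measurable M"
      and hv: "\<And>n. AE x in M. norm (v n x) = h n x"
    by metis
  let ?r = "(1/2) powr p"
  have le': "(\<integral>\<^sup>+ x. ennreal ((2^n) powr p) * ennreal (h n x powr p) \<partial>M) \<le> ennreal (C powr p * ?r^n)" for n
  proof -
    have "(\<integral>\<^sup>+ x. ennreal ((2^n) powr p) * ennreal (h n x powr p) \<partial>M)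
        = ennreal ((2^n) powr p) * (\<integral>\<^sup>+ x. ennreal (h n x powr p) \<partial>M)"
      by (rule nn_integral_cmult) measurable
    also have "(\<integral>\<^sup>+ x. ennreal (h n x powr p) \<partial>M) = Lp_integral p M (v n)"
      by (rule nn_integral_cong_AE) (use hv[of n] in \<open>auto elim!: eventually_mono\<close>)
    also have "ennreal ((2^n) powr p) * Lp_integral p M (v n)
        \<le> ennreal ((2^n) powr p) * ennreal ((C * (1/4)^n) powr p)"
      by (intro mult_left_mono le) auto
    also have "\<dots> = ennreal ((C * (2^n * (1/4)^n)) powr p)"
      using C by (simp add: powr_mult mult_ac flip: ennreal_mult')
    also have "(2::real)^n * (1/4)^n = (1/2)^n"
      by (simp flip: power_mult_distrib)
    also have "(C * (1/2)^n) powr p = C powr p * ?r^n"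
      using C by (simp add: powr_mult powr_powr mult.commute flip: powr_realpow)
    finally show ?thesis .
  qed
  have "(\<integral>\<^sup>+ x. (\<Sum>n. ennreal ((2^n) powr p) * ennreal (h n x powr p)) \<partial>M)
      = (\<Sum>n. \<integral>\<^sup>+ x. ennreal ((2^n) powr p) * ennreal (h n x powr p) \<partial>M)"
    by (rule nn_integral_suminf) measurable
  also have "\<dots> \<le> (\<Sum>n. ennreal (C powr p * ?r^n))"
    by (intro suminf_le le') auto
  also have "\<dots> < \<infinity>"
  proof -
    have "?r < 1 powr p"
      using p by (intro powr_less_mono2) auto
    then have "summable (\<lambda>n. C powr p * ?r^n)"
      by (intro summable_mult summable_geometric) simp
    then show ?thesis
      by (simp add: suminf_ennreal2)
  qed
  finally have "AE x in M. (\<Sum>n. ennreal ((2^n) powr p) * ennreal (h n x powr p)) \<noteq> \<infinity>"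
    by (intro nn_integral_noteq_infinite) auto
  moreover have "AE x in M. \<forall>n. norm (v n x) = h n x"
    using hv by (simp add: AE_all_countable)
  ultimately show ?thesis
  proof eventually_elim
    case (elim x)
    have "ennreal ((2^n) powr p) * ennreal (h n x powr p) = ennreal ((2^n * norm (v n x)) powr p)" for n
      using elim(2) by (simp add: powr_mult flip: ennreal_mult')
    then have "summable (\<lambda>n. (2^n * norm (v n x)) powr p)"
      using elim(1) by (intro summable_suminf_not_top) (auto simp: top_ennreal.rep_eq)
    then have "(\<lambda>n. (2^n * norm (v n x)) powr p) \<longlonglongrightarrow> 0"
      by (rule summable_LIMSEQ_zero)
    then have "(\<lambda>n. ((2^n * norm (v n x)) powr p) powr (1/p)) \<longlonglongrightarrow> 0"
      by (rule tendsto_zero_powrI[OF _ tendsto_const]) (use p in auto)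
    then show ?case
      using p by (simp add: powr_powr)
  qed
qed

lemma finite_measure_lebesgue_on_Icc: "finite_measure (lebesgue_on {a..b::real})"
  by (rule finite_measure_lebesgue_on) simp

lemma Lp_integral_diff_le:
  assumes "1 \<le> p" "p_integrable_on p {0..1} u" "p_integrable_on p {0..1} v"
    and "Lp_norm p (ae_class u - ae_class v) \<le> r"
  shows "Lp_integral p (lebesgue_on {0..1}) (\<lambda>s. u s - v s) \<le> ennreal (r powr p)"
  using Lp_integral_le[OF assms(1) p_integrable_on_diff[OF assms(1-3)]] assms(4)
  by (simp add: minus_ae_fun.abs_eq)

text \<open>At almost every point the consecutive differences are eventually at most
  \<open>(1/2)^n\<close>, so the telescoping series converges absolutely, and completeness of the
  value space gives the limit.\<close>

lemma Lp_Cauchy_convergent_AE: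
  fixes w :: "nat \<Rightarrow> real \<Rightarrow> 'x::banach"
  assumes p: "1 \<le> p" and C: "0 \<le> C" and w: "\<And>n. p_integrable_on p {0..1} (w n)"
    and Cauchy: "\<And>m n. Lp_norm p (ae_class (w m) - ae_class (w n)) \<le> C * ((1/4)^m + (1/4)^n)"
  shows "AE s in lebesgue_on {0..1}. convergent (\<lambda>n. w n s)"
proof -
  have "AE s in lebesgue_on {0..1}. (\<lambda>n. 2^n * norm (w (Suc n) s - w n s)) \<longlonglongrightarrow> 0"
  proof (rule Lp_geometric_decay_tendsto_AE[OF p])
    show "0 \<le> 2 * C" using C by simp
    show "strongly_measurable (lebesgue_on {0..1}) (\<lambda>s. w (Suc n) s - w n s)" for n
      using w strongly_measurable_diff unfolding p_integrable_on_def by blast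
    have "Lp_norm p (ae_class (w (Suc n)) - ae_class (w n)) \<le> 2 * C * (1/4)^n" for n
    proof -
      have "C * ((1/4)^Suc n + (1/4)^n) \<le> C * (2 * (1/4)^n)"
        using C by (intro mult_left_mono) auto
      then show ?thesis
        using Cauchy[of "Suc n" n] by simp
    qed
    then show "Lp_integral p (lebesgue_on {0..1}) (\<lambda>s. w (Suc n) s - w n s)
        \<le> ennreal ((2 * C * (1/4)^n) powr p)" for n
      by (intro Lp_integral_diff_le p w)
  qed
  then show ?thesis
  proof eventually_elim
    case (elim s)
    have "eventually (\<lambda>n. 2^n * norm (w (Suc n) s - w n s) < 1) sequentially"
      using order_tendstoD(2)[OF elim, of 1] by simp
    then have "eventually (\<lambda>n. norm (w (Suc n) s - w n s) \<le> (1/2)^n) sequentially"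
      by eventually_elim (simp add: field_simps)
    then have "summable (\<lambda>n. w (Suc n) s - w n s)"
      by (rule summable_comparison_test_ev) (simp add: summable_geometric)
    then have "convergent (\<lambda>n. w n s - w 0 s)"
      by (simp add: summable_iff_convergent sum_lessThan_telescope[of "\<lambda>n. w n s"])
    then obtain L where "(\<lambda>n. w n s - w 0 s) \<longlonglongrightarrow> L"
      unfolding convergent_def by blast
    from tendsto_add[OF this tendsto_const[of "w 0 s"]] show ?case
      by (auto simp: convergent_def)
  qed
qed

text \<open>Fatou's lemma is applied in \<open>m\<close> to \<open>w n s - w m s\<close> with
  \<open>n\<close> fixed. For \<open>m \<ge> n\<close> the Cauchy bound is at most
  \<open>2 * C * (1/4)^n\<close>, and this survives in the limit.\<close>

lemma Lp_Cauchy_limit: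
  fixes w :: "nat \<Rightarrow> real \<Rightarrow> 'x::banach"
  assumes p: "1 \<le> p" and C: "0 \<le> C" and w: "\<And>n. p_integrable_on p {0..1} (w n)"
    and Cauchy: "\<And>m n. Lp_norm p (ae_class (w m) - ae_class (w n)) \<le> C * ((1/4)^m + (1/4)^n)"
    and lim: "AE s in lebesgue_on {0..1}. (\<lambda>n. w n s) \<longlonglongrightarrow> v s"
  shows "p_integrable_on p {0..1} v"
    and "Lp_norm p (ae_class (w n) - ae_class v) \<le> 2 * C * (1/4)^n"
proof -
  let ?L = "lebesgue_on {0..1::real}"
  have sm: "strongly_measurable ?L v"
    using w by (intro finite_measure.strongly_measurable_LIMSEQ[OF finite_measure_lebesgue_on_Icc _ lim])
      (simp add: p_integrable_on_def)
  have le: "Lp_integral p ?L (\<lambda>s. w n s - v s) \<le> ennreal ((2 * C * (1/4)^n) powr p)" for n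
  proof -
    have "\<exists>h. h \<in> borel_measurable ?L \<and> (AE s in ?L. norm (w n s - w m s) = h s)" for m
    proof -
      have "strongly_measurable ?L (\<lambda>s. w n s - w m s)"
        using w by (intro strongly_measurable_diff) (simp_all add: p_integrable_on_def)
      then show ?thesis
        using strongly_measurable_norm by blast
    qed
    then obtain h where h[measurable]: "\<And>m. h m \<in> borel_measurable ?L"
        and hw: "\<And>m. AE s in ?L. norm (w n s - w m s) = h m s"
      by metis
    have "AE s in ?L. \<forall>m. norm (w n s - w m s) = h m s"
      using hw by (simp add: AE_all_countable)
    with lim have "AE s in ?L. ennreal (norm (w n s - v s) powr p)
        = liminf (\<lambda>m. ennreal (h m s powr p))"
    proof eventually_elim
      case (elim s)
      have "(\<lambda>m. ennreal (norm (w n s - w m s) powr p)) \<longlonglongrightarrow> ennreal (norm (w n s - v s) powr p)"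
        using p by (intro tendsto_ennrealI tendsto_powr' tendsto_norm tendsto_diff tendsto_const elim) auto
      then show ?case
        using elim(2) by (intro lim_imp_Liminf[symmetric]) auto
    qed
    then have "Lp_integral p ?L (\<lambda>s. w n s - v s) = (\<integral>\<^sup>+ s. liminf (\<lambda>m. ennreal (h m s powr p)) \<partial>?L)"
      by (rule nn_integral_cong_AE)
    also have "\<dots> \<le> liminf (\<lambda>m. \<integral>\<^sup>+ s. ennreal (h m s powr p) \<partial>?L)"
      by (rule nn_integral_liminf) measurable
    also have "\<dots> \<le> limsup (\<lambda>m. \<integral>\<^sup>+ s. ennreal (h m s powr p) \<partial>?L)"
      by (rule Liminf_le_Limsup) simp
    also have "\<dots> \<le> ennreal ((2 * C * (1/4)^n) powr p)"
    proof (rule Limsup_bounded)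
      show "\<forall>\<^sub>F m in sequentially. (\<integral>\<^sup>+ s. ennreal (h m s powr p) \<partial>?L) \<le> ennreal ((2 * C * (1/4)^n) powr p)"
        using eventually_ge_at_top[of n]
      proof eventually_elim
        case (elim m)
        have "C * ((1/4)^n + (1/4)^m) \<le> C * (2 * (1/4)^n)"
          using C power_decreasing[OF elim, of "1/4::real"] by (intro mult_left_mono) auto
        then have "Lp_norm p (ae_class (w n) - ae_class (w m)) \<le> 2 * C * (1/4)^n"
          using Cauchy[of n m] by simp
        then have "Lp_integral p ?L (\<lambda>s. w n s - w m s) \<le> ennreal ((2 * C * (1/4)^n) powr p)"
          by (intro Lp_integral_diff_le p w)
        moreover have "(\<integral>\<^sup>+ s. ennreal (h m s powr p) \<partial>?L) = Lp_integral p ?L (\<lambda>s. w n s - w m s)"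
          by (rule nn_integral_cong_AE) (use hw[of m] in \<open>auto elim!: eventually_mono\<close>)
        ultimately show ?case by simp
      qed
    qed
    finally show ?thesis .
  qed
  have diff: "p_integrable_on p {0..1} (\<lambda>s. w n s - v s)" for n
    using le_less_trans[OF le[of n] ennreal_less_top] strongly_measurable_diff[OF _ sm] w
    unfolding p_integrable_on_def by auto
  show "p_integrable_on p {0..1} v"
    \<comment> \<open>The limit is written as \<open>v = w 0 - (w 0 - v)\<close>, a difference of
      integrable functions.\<close>
    using p_integrable_on_diff[OF p w diff, of 0 0] by simp
  show "Lp_norm p (ae_class (w n) - ae_class v) \<le> 2 * C * (1/4)^n"
    using Lp_norm_leI[OF p _ le[of n]] C by (simp add: minus_ae_fun.abs_eq)
qed

section \<open>Local integrability and translations\<close>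

lemma p_integrable_on_iff_UNIV:
  assumes "S \<in> sets lebesgue"
  shows "p_integrable_on p S u \<longleftrightarrow> p_integrable_on p UNIV (\<lambda>x. indicator S x *\<^sub>R u x)"
proof -
  have "Lp_integral p (lebesgue_on S) u
      = (\<integral>\<^sup>+ x. ennreal (norm (u x) powr p) * indicator S x \<partial>lebesgue)"
    using assms by (intro nn_integral_restrict_space) simp
  also have "\<dots> = Lp_integral p lebesgue (\<lambda>x. indicator S x *\<^sub>R u x)"
    by (intro nn_integral_cong) (auto split: split_indicator)
  finally show ?thesis
    using assms by (simp add: p_integrable_on_def strongly_measurable_restrict_iff lebesgue_on_UNIV_eq)
qed

lemma p_integrable_on_subset:
  assumes "p_integrable_on p T u" "S \<subseteq> T" "S \<in> sets lebesgue" "T \<in> sets lebesgue"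
  shows "p_integrable_on p S u"
proof -
  let ?u = "\<lambda>x. indicator T x *\<^sub>R u x"
  have u: "p_integrable_on p UNIV ?u"
    using assms(1,4) p_integrable_on_iff_UNIV by blast
  have eq: "(\<lambda>x. indicator S x *\<^sub>R u x) = (\<lambda>x. indicator S x *\<^sub>R ?u x)"
    using assms(2) by (intro ext) (auto simp: indicator_def)
  have "strongly_measurable lebesgue (\<lambda>x. indicator S x *\<^sub>R u x)"
    unfolding eq
    by (rule strongly_measurable_scaleR[OF simple_function_indicator])
      (use u assms(3) in \<open>auto simp: p_integrable_on_def lebesgue_on_UNIV_eq\<close>)
  moreover have "Lp_integral p lebesgue (\<lambda>x. indicator S x *\<^sub>R u x) \<le> Lp_integral p lebesgue ?u"
    using assms(2) by (intro nn_integral_mono) (auto split: split_indicator)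
  ultimately have "p_integrable_on p UNIV (\<lambda>x. indicator S x *\<^sub>R u x)"
    using u by (auto simp: p_integrable_on_def lebesgue_on_UNIV_eq intro: le_less_trans)
  then show ?thesis
    using assms(3) p_integrable_on_iff_UNIV by blast
qed

lemma p_integrable_on_Un:
  assumes "1 \<le> p" "p_integrable_on p S u" "p_integrable_on p T u" "S \<in> sets lebesgue" "T \<in> sets lebesgue"
  shows "p_integrable_on p (S \<union> T) u"
proof -
  \<comment> \<open>Replacing \<open>T\<close> by \<open>T - S\<close> makes the two pieces
    disjoint, so that their indicators add up to the indicator of the union.\<close>
  have TS: "T - S \<in> sets lebesgue"
    using assms(4,5) by auto
  have "p_integrable_on p (T - S) u"
    by (rule p_integrable_on_subset[OF assms(3) _ TS assms(5)]) auto
  then have "p_integrable_on p UNIV (\<lambda>x. indicator (T - S) x *\<^sub>R u x)"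
    by (rule iffD1[OF p_integrable_on_iff_UNIV[OF TS]])
  with iffD1[OF p_integrable_on_iff_UNIV[OF assms(4)] assms(2)]
  have "p_integrable_on p UNIV (\<lambda>x. indicator S x *\<^sub>R u x + indicator (T - S) x *\<^sub>R u x)"
    by (rule p_integrable_on_add[OF assms(1)])
  also have "(\<lambda>x. indicator S x *\<^sub>R u x + indicator (T - S) x *\<^sub>R u x)
      = (\<lambda>x. indicator (S \<union> T) x *\<^sub>R u x)"
    by (intro ext) (auto simp: indicator_def)
  finally show ?thesis
    using assms(4,5) p_integrable_on_iff_UNIV[of "S \<union> T"] by blast
qed

text \<open>Translation invariance of Lebesgue measure, phrased as an image measure: this carries
  almost everywhere statements and integrals from \<open>{0..1}\<close>, where Bochner transforms
  live, to an arbitrary unit interval.\<close>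

lemma
  fixes t :: real
  shows measurable_shift_lebesgue_on:
      "(\<lambda>x. x - t) \<in> measurable (lebesgue_on {t..t+1}) (lebesgue_on {0..1})"
    and distr_shift_lebesgue_on:
      "distr (lebesgue_on {t..t+1}) (lebesgue_on {0..1}) (\<lambda>x. x - t) = lebesgue_on {0..1}"
proof -
  have "(\<lambda>x. x - t) \<in> measurable lebesgue lebesgue"
    using lebesgue_affine_measurable[of "\<lambda>_. 1" "- t"] by simp
  then show T: "(\<lambda>x. x - t) \<in> measurable (lebesgue_on {t..t+1}) (lebesgue_on {0..1})"
    by (rule measurable_restrict_space3) auto
  show "distr (lebesgue_on {t..t+1}) (lebesgue_on {0..1}) (\<lambda>x. x - t) = lebesgue_on {0..1}"
  proof (rule measure_eqI)
    fix A assume "A \<in> sets (distr (lebesgue_on {t..t+1}) (lebesgue_on {0..1}) (\<lambda>x. x - t))"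
    then have A: "A \<in> sets (lebesgue_on {0..1})" by simp
    then have sub: "A \<subseteq> {0..1}"
      using sets.sets_into_space[OF A] by simp
    have "emeasure (distr (lebesgue_on {t..t+1}) (lebesgue_on {0..1}) (\<lambda>x. x - t)) A
        = emeasure (lebesgue_on {t..t+1}) ((\<lambda>x. x - t) -` A \<inter> {t..t+1})"
      using T A by (simp add: emeasure_distr)
    also have "(\<lambda>x. x - t) -` A \<inter> {t..t+1} = (\<lambda>x. x + t) ` A"
      using sub by (force simp: image_iff)
    also have "emeasure (lebesgue_on {t..t+1}) ((\<lambda>x. x + t) ` A) = emeasure lebesgue ((\<lambda>x. x + t) ` A)"
      using sub by (intro emeasure_restrict_space) auto
    also have "\<dots> = emeasure lebesgue A"
      using emeasure_lebesgue_affine[of 1 t A] by (simp add: add.commute)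
    also have "\<dots> = emeasure (lebesgue_on {0..1}) A"
      using sub by (intro emeasure_restrict_space[symmetric]) auto
    finally show "emeasure (distr (lebesgue_on {t..t+1}) (lebesgue_on {0..1}) (\<lambda>x. x - t)) A
        = emeasure (lebesgue_on {0..1}) A" .
  qed simp
qed

lemma AE_lebesgue_on_shift:
  fixes t :: real
  assumes "AE s in lebesgue_on {0..1}. P (t + s)"
  shows "AE x in lebesgue_on {t..t+1}. P x"
  using AE_distrD[OF measurable_shift_lebesgue_on[of t], of "\<lambda>s. P (t + s)",
      unfolded distr_shift_lebesgue_on, OF assms]
  by simp

text \<open>The half-line is covered by countably many unit intervals, and the exceptional null sets
  are united.\<close>

lemma AE_lebesgue_on_halfline:
  assumes "\<And>k::nat. AE s in lebesgue_on {0..1}. P (real k + s)"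
  shows "AE x in lebesgue_on {0..}. P x"
proof -
  have "AE x in lebesgue. x \<in> {real k..real k + 1} \<longrightarrow> P x" for k
    using AE_lebesgue_on_shift[OF assms[of k]] by (subst (asm) AE_restrict_space_iff) auto
  then have "AE x in lebesgue. \<forall>k. x \<in> {real k..real k + 1} \<longrightarrow> P x"
    by (simp only: AE_all_countable) blast
  then have "AE x in lebesgue. x \<in> {0..} \<longrightarrow> P x"
  proof eventually_elim
    case (elim x)
    have "x \<in> {real (nat \<lfloor>x\<rfloor>)..real (nat \<lfloor>x\<rfloor>) + 1}" if "0 \<le> x"
      using that by (auto intro: less_imp_le)
    with elim show ?case by (metis atLeast_iff)
  qed
  then show ?thesis
    by (subst AE_restrict_space_iff) auto
qed

lemma p_integrable_on_shift:
  assumes "p_integrable_on p {0..1} (\<lambda>s. u (t + s))"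
  shows "p_integrable_on p {t..t+1} u"
proof -
  note T = measurable_shift_lebesgue_on[of t] distr_shift_lebesgue_on[of t]
  have sm: "strongly_measurable (lebesgue_on {0..1}) (\<lambda>s. u (t + s))"
    using assms by (simp add: p_integrable_on_def)
  have sm': "strongly_measurable (lebesgue_on {t..t+1}) u"
    using strongly_measurable_comp[OF T sm] by simp
  obtain h where h[measurable]: "h \<in> borel_measurable (lebesgue_on {0..1})"
      and hu: "AE s in lebesgue_on {0..1}. norm (u (t + s)) = h s"
    using strongly_measurable_norm[OF sm] .
  have "AE x in lebesgue_on {t..t+1}. norm (u x) = h (x - t)"
    using AE_lebesgue_on_shift[where t = t and P = "\<lambda>x. norm (u x) = h (x - t)"] hu by simp
  then have "Lp_integral p (lebesgue_on {t..t+1}) u = (\<integral>\<^sup>+ x. ennreal (h (x - t) powr p) \<partial>lebesgue_on {t..t+1})"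
    by (intro nn_integral_cong_AE) (auto elim!: eventually_mono)
  also have "\<dots> = (\<integral>\<^sup>+ s. ennreal (h s powr p) \<partial>distr (lebesgue_on {t..t+1}) (lebesgue_on {0..1}) (\<lambda>x. x - t))"
    by (rule nn_integral_distr[OF T(1), symmetric]) simp
  also have "\<dots> = Lp_integral p (lebesgue_on {0..1}) (\<lambda>s. u (t + s))"
    unfolding T(2) by (intro nn_integral_cong_AE) (use hu in \<open>auto elim!: eventually_mono\<close>)
  finally have "Lp_integral p (lebesgue_on {t..t+1}) u < \<infinity>"
    using assms by (simp add: p_integrable_on_def)
  with sm' show ?thesis
    by (simp add: p_integrable_on_def)
qed

text \<open>Every bounded interval is covered by finitely many consecutive unit intervals starting
  at its left endpoint.\<close>

lemma locally_p_integrable_on_UNIV_I: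
  assumes "1 \<le> p" "\<And>t. p_integrable_on p {0..1} (\<lambda>s. u (t + s))"
  shows "locally_p_integrable_on p UNIV u"
  unfolding locally_p_integrable_on_def
proof (intro allI impI)
  fix a b :: real
  have "p_integrable_on p {a..a + real (Suc n)} u" for n
  proof (induction n)
    case 0
    then show ?case using p_integrable_on_shift[OF assms(2)] by simp
  next
    case (Suc n)
    have eq: "{a..a + real (Suc (Suc n))} = {a..a + real (Suc n)} \<union> {a + real (Suc n)..(a + real (Suc n)) + 1}"
      by auto
    show ?case
      unfolding eq by (rule p_integrable_on_Un[OF assms(1) Suc p_integrable_on_shift[OF assms(2)]]) auto
  qed
  moreover have "{a..b} \<subseteq> {a..a + real (Suc (nat \<lceil>b - a\<rceil>))}"
    by auto linarith
  ultimately show "p_integrable_on p {a..b} u"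
    by (rule p_integrable_on_subset) auto
qed

section \<open>Almost periodic functions\<close>

lemma almost_periodicD:
  assumes "almost_periodic Z N I F" "0 < e" "compact K"
  obtains l where "0 < l" "\<And>a. {a..a + l} \<subseteq> I \<Longrightarrow>
    \<exists>\<tau>\<in>{a..a + l}. \<forall>t\<in>I. \<forall>y\<in>K. N (F (t + \<tau>) y - F t y) \<le> e"
proof -
  from assms(1)[unfolded almost_periodic_def, THEN conjunct2, THEN conjunct2, rule_format, OF assms(2,3)]
  obtain l where "0 < l \<and> (\<forall>a. {a..a + l} \<subseteq> I \<longrightarrow>
    (\<exists>\<tau>\<in>{a..a + l}. \<forall>t\<in>I. \<forall>y\<in>K. N (F (t + \<tau>) y - F t y) \<le> e))" ..
  then show ?thesis
    by (intro that[of l]) simp_all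
qed

text \<open>Isolates what the extension argument uses of \<open>Lp p\<close> inside its ambient
  space. The triangle inequality is required on the carrier only: outside \<open>Lp p\<close>,
  \<open>Lp_norm p\<close> may read an infinite integral as zero. Hence the membership assumptions
  throughout.\<close>

locale seminormed_subgroup =
  fixes Z :: "'z::real_vector set" and N :: "'z \<Rightarrow> real"
  assumes add_mem: "x \<in> Z \<Longrightarrow> y \<in> Z \<Longrightarrow> x + y \<in> Z"
    and uminus_mem: "x \<in> Z \<Longrightarrow> - x \<in> Z"
    and seminorm_zero: "N 0 = 0"
    and seminorm_nonneg: "0 \<le> N x"
    and seminorm_uminus: "N (- x) = N x"
    and seminorm_add_le: "x \<in> Z \<Longrightarrow> y \<in> Z \<Longrightarrow> N (x + y) \<le> N x + N y"
begin

lemma diff_mem: "x \<in> Z \<Longrightarrow> y \<in> Z \<Longrightarrow> x - y \<in> Z"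
  using add_mem[of x "- y"] uminus_mem by simp

lemma seminorm_diff_commute: "N (x - y) = N (y - x)"
  using seminorm_uminus[of "x - y"] by simp

lemma seminorm_diff_triangle:
  assumes "x \<in> Z" "y \<in> Z" "z \<in> Z"
  shows "N (x - z) \<le> N (x - y) + N (y - z)"
  using seminorm_add_le[OF diff_mem[OF assms(1,2)] diff_mem[OF assms(2,3)]] by simp

lemma seminorm_le_diff:
  assumes "x \<in> Z" "y \<in> Z"
  shows "N x \<le> N (x - y) + N y"
  using seminorm_add_le[OF diff_mem[OF assms] assms(2)] by simp

lemma seminorm_limits_eq:
  assumes "x \<in> Z" "y \<in> Z" "\<forall>\<^sub>F n in sequentially. z n \<in> Z"
    and "(\<lambda>n. N (z n - x)) \<longlonglongrightarrow> 0" "(\<lambda>n. N (z n - y)) \<longlonglongrightarrow> 0"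
  shows "N (x - y) = 0"
proof -
  have "N (x - y) \<le> 0"
  proof (rule tendsto_le[OF _ _ tendsto_const])
    show "(\<lambda>n. N (z n - x) + N (z n - y)) \<longlonglongrightarrow> 0"
      using tendsto_add[OF assms(4,5)] by simp
    show "\<forall>\<^sub>F n in sequentially. N (x - y) \<le> N (z n - x) + N (z n - y)"
      using assms(3)
    proof eventually_elim
      case (elim n)
      then show ?case
        using seminorm_diff_triangle[OF assms(1) elim assms(2)] seminorm_diff_commute[of x "z n"] by simp
    qed
  qed simp
  with seminorm_nonneg show ?thesis
    by (metis order_antisym)
qed

text \<open>The values of \<open>H\<close> at negative times are limits of \<open>G\<close> along translations towards infinity, so every
  almost period of \<open>G\<close> is one of \<open>H\<close>. Continuity of \<open>H\<close> at a negative time is seen after a shift by an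
  almost period into the half-line, for the compact set formed by a convergent sequence.\<close>

lemma almost_periodic_extend:
  fixes G H :: "real \<Rightarrow> 'y::metric_space \<Rightarrow> 'z"
  assumes G: "almost_periodic Z N {0..} G"
    and HZ: "\<And>t y. H t y \<in> Z"
    and HG: "\<And>t y. 0 \<le> t \<Longrightarrow> H t y = G t y"
    and approx: "\<And>y. \<exists>\<sigma>::nat \<Rightarrow> real. filterlim \<sigma> at_top sequentially \<and>
      (\<forall>t. (\<lambda>n. N (H t y - G (t + \<sigma> n) y)) \<longlonglongrightarrow> 0)"
  shows "almost_periodic Z N UNIV H"
proof -
  have GZ: "G t y \<in> Z" if "0 \<le> t" for t y
    using HZ[of t y] HG[OF that] by simp
  \<comment> \<open>One translation \<open>\<sigma>\<close> serves two times at once, so that a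
    difference of values of \<open>H\<close> can be compared with a difference of values of
    \<open>G\<close> on the half-line.\<close>
  have shift: "\<exists>\<sigma>. 0 \<le> s + \<sigma> \<and> 0 \<le> t + \<sigma> \<and> N (H s y - G (s + \<sigma>) y) < e \<and> N (H t y - G (t + \<sigma>) y) < e"
    if "0 < e" for s t y e
  proof -
    obtain \<sigma> :: "nat \<Rightarrow> real" where \<sigma>: "filterlim \<sigma> at_top sequentially"
        "\<And>t. (\<lambda>n. N (H t y - G (t + \<sigma> n) y)) \<longlonglongrightarrow> 0"
      using approx[of y] by blast
    have "\<forall>\<^sub>F n in sequentially. max (- s) (- t) \<le> \<sigma> n"
      using \<sigma>(1) unfolding filterlim_at_top by blast
    moreover have "\<forall>\<^sub>F n in sequentially. N (H r y - G (r + \<sigma> n) y) < e" for r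
      using order_tendstoD(2)[OF \<sigma>(2) that] .
    ultimately have "\<forall>\<^sub>F n in sequentially. max (- s) (- t) \<le> \<sigma> n \<and>
        N (H s y - G (s + \<sigma> n) y) < e \<and> N (H t y - G (t + \<sigma> n) y) < e"
      by (intro eventually_conj)
    then obtain n where "max (- s) (- t) \<le> \<sigma> n \<and>
        N (H s y - G (s + \<sigma> n) y) < e \<and> N (H t y - G (t + \<sigma> n) y) < e"
      using eventually_happens'[OF sequentially_bot] by blast
    then show ?thesis
      by (intro exI[of _ "\<sigma> n"]) auto
  qed
  \<comment> \<open>The approximation error \<open>d\<close> is arbitrary, so an almost period of
    \<open>G\<close> passes to \<open>H\<close> with no loss in \<open>e\<close>.\<close>
  have period: "N (H (t + \<tau>) y - H t y) \<le> e"
    if \<tau>: "\<And>t. 0 \<le> t \<Longrightarrow> N (G (t + \<tau>) y - G t y) \<le> e" for \<tau> y e t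
  proof (rule field_le_epsilon)
    fix d :: real assume "0 < d"
    then have "0 < d/2" by simp
    from shift[OF this, of "t + \<tau>" t y] obtain \<sigma> where \<sigma>: "0 \<le> t + \<tau> + \<sigma>" "0 \<le> t + \<sigma>"
        "N (H (t + \<tau>) y - G (t + \<tau> + \<sigma>) y) < d/2" "N (H t y - G (t + \<sigma>) y) < d/2"
      by blast
    have "N (G (t + \<tau> + \<sigma>) y - G (t + \<sigma>) y) \<le> e"
      using \<tau>[OF \<sigma>(2)] by (simp add: add_ac)
    with \<sigma> show "N (H (t + \<tau>) y - H t y) \<le> e + d"
      using seminorm_diff_triangle[OF HZ[of "t + \<tau>" y] GZ[OF \<sigma>(1)] HZ[of t y], of y]
        seminorm_diff_triangle[OF GZ[OF \<sigma>(1)] GZ[OF \<sigma>(2)] HZ[of t y], of y y]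
        seminorm_diff_commute[of "H t y" "G (t + \<sigma>) y"]
      by linarith
  qed
  have periods: "\<exists>l>0. \<forall>a\<ge>0. \<exists>\<tau>\<in>{a..a + l}. \<forall>t. \<forall>y\<in>K. N (H (t + \<tau>) y - H t y) \<le> e"
    if "0 < e" "compact K" for e K
  proof -
    obtain l where l: "0 < l" "\<And>a. {a..a + l} \<subseteq> {0..} \<Longrightarrow>
        \<exists>\<tau>\<in>{a..a + l}. \<forall>t\<in>{0..}. \<forall>y\<in>K. N (G (t + \<tau>) y - G t y) \<le> e"
      by (rule almost_periodicD[OF G \<open>0 < e\<close> \<open>compact K\<close>]) (rule that)
    have "\<exists>\<tau>\<in>{a..a + l}. \<forall>t. \<forall>y\<in>K. N (H (t + \<tau>) y - H t y) \<le> e" if "0 \<le> a" for a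
    proof -
      have "{a..a + l} \<subseteq> {0..}"
        using that by auto
      from l(2)[OF this] obtain \<tau> where \<tau>: "\<tau> \<in> {a..a + l}"
          "\<forall>t\<in>{0..}. \<forall>y\<in>K. N (G (t + \<tau>) y - G t y) \<le> e" ..
      have "N (H (t + \<tau>) y - H t y) \<le> e" if "y \<in> K" for t y
        by (rule period) (use \<tau>(2) that in simp)
      with \<tau>(1) show ?thesis by blast
    qed
    with l(1) show ?thesis by blast
  qed
  show ?thesis
    unfolding almost_periodic_def
  proof (intro conjI allI impI)
    obtain C where C: "\<And>t y. 0 \<le> t \<Longrightarrow> N (G t y) \<le> C"
      using G unfolding almost_periodic_def norm_bounded_def by auto
    have "N (H t y) \<le> C + 1" for t y
    proof -
      obtain \<sigma> where \<sigma>: "0 \<le> t + \<sigma>" "N (H t y - G (t + \<sigma>) y) < 1"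
        using shift[OF zero_less_one, of t t y] by blast
      then show ?thesis
        using seminorm_le_diff[OF HZ[of t y] GZ[OF \<sigma>(1)], of y] C[OF \<sigma>(1), of y] by simp
    qed
    then show "norm_bounded N UNIV H"
      unfolding norm_bounded_def by blast
  next
    have "\<exists>\<delta>>0. \<forall>s z. dist (s, z) (t, y) < \<delta> \<longrightarrow> N (H s z - H t y) < e" if e: "0 < e" for t y e
    proof (rule ccontr)
      assume "\<not> ?thesis"
      then have "\<exists>s z. dist (s, z) (t, y) < inverse (real (Suc n)) \<and> \<not> N (H s z - H t y) < e" for n
        by (metis inverse_positive_iff_positive of_nat_0_less_iff zero_less_Suc)
      then obtain s z where sz: "\<And>n. dist (s n, z n) (t, y) < inverse (real (Suc n))"
          "\<And>n. \<not> N (H (s n) (z n) - H t y) < e"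
        by metis
      have small: "\<forall>\<^sub>F n in sequentially. dist (s n, z n) (t, y) < d" if "0 < d" for d
      proof -
        have "\<forall>\<^sub>F n in sequentially. inverse (real (Suc n)) < d"
          using order_tendstoD(2)[OF LIMSEQ_inverse_real_of_nat that] .
        then show ?thesis
          by eventually_elim (rule less_trans[OF sz(1)])
      qed
      have "z \<longlonglongrightarrow> y"
      proof (rule tendstoI)
        fix d :: real assume "0 < d"
        from small[OF this] show "\<forall>\<^sub>F n in sequentially. dist (z n) y < d"
          by eventually_elim (metis dist_snd_le le_less_trans snd_conv)
      qed
      then have "compact (insert y (range z))"
        using compactin_sequence_with_limit[of euclidean z y "range z"] by (simp add: compactin_euclidean_iff)
      with e obtain l where l: "\<forall>a\<ge>0. \<exists>\<tau>\<in>{a..a + l}. \<forall>t. \<forall>x\<in>insert y (range z).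
          N (H (t + \<tau>) x - H t x) \<le> e/3"
        using periods[of "e/3" "insert y (range z)"] by (meson divide_pos_pos zero_less_numeral)
      \<comment> \<open>Starting at \<open>1 - t\<close> or later gives
        \<open>t + \<tau> \<ge> 1\<close>, so every time within distance \<open>1\<close> of
        \<open>t\<close> is moved into the half-line as well, where continuity of \<open>G\<close>
        is available.\<close>
      obtain \<tau> where "\<tau> \<in> {max 0 (1 - t)..max 0 (1 - t) + l}"
          "\<forall>t. \<forall>x\<in>insert y (range z). N (H (t + \<tau>) x - H t x) \<le> e/3"
        using l[rule_format, of "max 0 (1 - t)"] by auto
      then have \<tau>: "max 0 (1 - t) \<le> \<tau>" "\<And>t. N (H (t + \<tau>) y - H t y) \<le> e/3"
          "\<And>t n. N (H (t + \<tau>) (z n) - H t (z n)) \<le> e/3"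
        by simp_all
      then have t: "0 \<le> t + \<tau>" by simp
      with G e obtain d where d: "0 < d"
          "\<And>s z. 0 \<le> s \<Longrightarrow> dist (s, z) (t + \<tau>, y) < d \<Longrightarrow> N (G s z - G (t + \<tau>) y) < e/3"
        unfolding almost_periodic_def maps_continuously_def
        by (metis atLeast_iff divide_pos_pos zero_less_numeral)
      have "\<forall>\<^sub>F n in sequentially. dist (s n, z n) (t, y) < min d 1"
        by (rule small) (use d(1) in simp)
      then obtain n where n: "dist (s n, z n) (t, y) < min d 1"
        using eventually_happens'[OF sequentially_bot] by blast
      have "dist (s n) t < 1"
        using n dist_fst_le[of "(s n, z n)" "(t, y)"] by simp
      then have s: "0 \<le> s n + \<tau>"
        using \<tau>(1) unfolding dist_real_def by linarith
      have "dist (s n + \<tau>, z n) (t + \<tau>, y) < d"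
        using n by (simp add: dist_Pair_Pair)
      then have "N (H (s n + \<tau>) (z n) - H (t + \<tau>) y) < e/3"
        using d(2)[OF s] s t by (simp add: HG)
      then have "N (H (s n) (z n) - H t y) < e"
        using seminorm_diff_triangle[OF HZ[of "s n" "z n"] HZ[of "s n + \<tau>" "z n"] HZ[of t y]]
          seminorm_diff_triangle[OF HZ[of "s n + \<tau>" "z n"] HZ[of "t + \<tau>" y] HZ[of t y]]
          seminorm_diff_commute[of "H (s n) (z n)" "H (s n + \<tau>) (z n)"] \<tau>(2)[of t] \<tau>(3)[of "s n" n]
        by linarith
      with sz(2) show False by blast
    qed
    then show "maps_continuously Z N UNIV H"
      unfolding maps_continuously_def using HZ by blast
  next
    fix e :: real and K :: "'y set"
    assume "0 < e" "compact K"
    from periods[OF this] obtain l where l: "0 < l"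
      "\<And>a. 0 \<le> a \<Longrightarrow> \<exists>\<tau>\<in>{a..a + l}. \<forall>t. \<forall>y\<in>K. N (H (t + \<tau>) y - H t y) \<le> e" by blast
    have "\<exists>\<tau>\<in>{a..a + l}. \<forall>t. \<forall>y\<in>K. N (H (t + \<tau>) y - H t y) \<le> e" for a
    proof -
      \<comment> \<open>For an interval left of the origin, an almost period of the reflected
        interval is negated: replacing \<open>t\<close> by \<open>t - \<tau>\<close> shows that
        \<open>- \<tau>\<close> is an almost period too. An interval containing the origin has the
        trivial almost period \<open>0\<close>.\<close>
      consider "0 \<le> a" | "a + l \<le> 0" | "a \<le> 0" "0 \<le> a + l" by linarith
      then show ?thesis
      proof cases
        case 1
        then show ?thesis by (rule l(2))
      next
        case 2
        then obtain \<tau> where \<tau>: "\<tau> \<in> {- (a + l)..- (a + l) + l}"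
            "\<forall>t. \<forall>y\<in>K. N (H (t + \<tau>) y - H t y) \<le> e"
          using l(2)[of "- (a + l)"] by auto
        have "N (H (t + - \<tau>) y - H t y) \<le> e" if "y \<in> K" for t y
          using \<tau>(2)[rule_format, OF that, of "t + - \<tau>"] seminorm_diff_commute by simp
        moreover have "- \<tau> \<in> {a..a + l}"
          using \<tau>(1) by auto
        ultimately show ?thesis by blast
      next
        case 3
        then show ?thesis
          using \<open>0 < e\<close> by (intro bexI[of _ 0]) (auto simp: seminorm_zero)
      qed
    qed
    with l(1) show "\<exists>l>0. \<forall>a. {a..a + l} \<subseteq> UNIV \<longrightarrow>
        (\<exists>\<tau>\<in>{a..a + l}. \<forall>t\<in>UNIV. \<forall>y\<in>K. N (H (t + \<tau>) y - H t y) \<le> e)"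
      by auto
  qed
qed

end

text \<open>Almost periods exist arbitrarily far out, so they can be chosen recursively beyond any
  threshold. The margin \<open>real n\<close> in the bound on \<open>Q\<close> covers all translated
  times \<open>t + \<theta> n\<close> with \<open>t \<ge> - real n\<close>, hence from some index on
  every given real \<open>t\<close>.\<close>

lemma almost_period_sequence:
  fixes G Q :: "real \<Rightarrow> 'y::metric_space \<Rightarrow> 'z::real_vector"
  assumes G: "almost_periodic Z N {0..} G" and Q: "Q \<in> C0_halfline Z N" and K: "compact K"
  obtains \<theta> :: "nat \<Rightarrow> real"
  where "strict_mono \<theta>" "\<And>n. real n < \<theta> n"
    "\<And>n t y. 0 \<le> t \<Longrightarrow> y \<in> K \<Longrightarrow> N (G (t + \<theta> n) y - G t y) \<le> (1/4)^n"
    "\<And>n t y. \<theta> n - real n \<le> t \<Longrightarrow> y \<in> K \<Longrightarrow> N (Q t y) \<le> (1/4)^n"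
proof -
  define P where "P n \<tau> \<longleftrightarrow> real n < \<tau> \<and> (\<forall>t\<ge>0. \<forall>y\<in>K. N (G (t + \<tau>) y - G t y) \<le> (1/4)^n) \<and>
    (\<forall>t\<ge>\<tau> - real n. \<forall>y\<in>K. N (Q t y) \<le> (1/4)^n)" for n \<tau>
  have ex: "\<exists>\<tau>. P n \<tau> \<and> M < \<tau>" for n M
  proof -
    have e: "(0::real) < (1/4)^n" by simp
    obtain l where l: "0 < l" "\<And>a. {a..a + l} \<subseteq> {0..} \<Longrightarrow>
        \<exists>\<tau>\<in>{a..a + l}. \<forall>t\<in>{0..}. \<forall>y\<in>K. N (G (t + \<tau>) y - G t y) \<le> (1/4)^n"
      by (rule almost_periodicD[OF G e K]) (rule that)
    have "\<forall>\<^sub>F t in at_top. \<forall>y\<in>K. dist (N (Q t y)) 0 < (1/4)^n"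
      using Q K e unfolding C0_halfline_def uniform_limit_iff by blast
    then obtain T where T: "\<And>t y. T \<le> t \<Longrightarrow> y \<in> K \<Longrightarrow> N (Q t y) \<le> (1/4)^n"
      unfolding eventually_at_top_linorder by (force simp: dist_real_def)
    \<comment> \<open>Starting at \<open>a\<close> puts the almost period beyond the previous term
      \<open>M\<close> and beyond \<open>n\<close>, strictly because of the \<open>+ 1\<close>, and
      keeps it at least \<open>n\<close> past the time \<open>T\<close> from which \<open>Q\<close>
      is small.\<close>
    define a where "a = max M (max (T + real n) (real n)) + 1"
    have "{a..a + l} \<subseteq> {0..}"
      by (auto simp: a_def)
    then obtain \<tau> where \<tau>: "a \<le> \<tau>" "\<forall>t\<in>{0..}. \<forall>y\<in>K. N (G (t + \<tau>) y - G t y) \<le> (1/4)^n"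
      using l(2) by (meson atLeastAtMost_iff)
    have "M < \<tau>" "real n < \<tau>" "T \<le> \<tau> - real n"
      using \<tau>(1) by (auto simp: a_def)
    with \<tau>(2) T show ?thesis
      unfolding P_def by (intro exI[of _ \<tau>]) auto
  qed
  have "\<exists>\<theta>. \<forall>n. P n (\<theta> n) \<and> \<theta> n < \<theta> (Suc n)"
    using ex by (intro dependent_nat_choice) blast+
  then obtain \<theta> where "\<And>n. P n (\<theta> n)" "\<And>n. \<theta> n < \<theta> (Suc n)"
    by blast
  then show ?thesis
    by (intro that[of \<theta>]) (auto simp: P_def strict_mono_Suc_iff)
qed

lemma seminormed_subgroup_Lp:
  assumes "1 \<le> p"
  shows "seminormed_subgroup (Lp p) (Lp_norm p)"
proof
  show "Lp_norm p 0 = 0"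
    by transfer simp
qed (use assms in \<open>auto intro: Lp_add Lp_uminus Lp_norm_nonneg Lp_norm_uminus Lp_norm_triangle\<close>)

theorem lemma1p6:
  fixes p :: real
    and f :: "real \<Rightarrow> 'y::complex_banach \<Rightarrow> 'x::complex_banach"
  assumes "1 \<le> p"
    and "asymptotically_Sp_almost_periodic p f"
  shows "\<exists>(g :: real \<Rightarrow> 'y \<Rightarrow> 'x) (q :: real \<Rightarrow> 'y \<Rightarrow> 'x).
    (\<forall>y. locally_p_integrable_on p UNIV (\<lambda>t. g t y)) \<and>
    (\<forall>y. locally_p_integrable_on p {0..} (\<lambda>t. q t y)) \<and>
    almost_periodic (Lp p) (Lp_norm p) UNIV (bochner_transform g) \<and>
    bochner_transform q \<in> C0_halfline (Lp p) (Lp_norm p) \<and>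
    (\<forall>t\<ge>0. \<forall>y. f t y = g t y + q t y) \<and>
    (\<forall>K. compact K \<longrightarrow>
      (\<exists>\<theta> :: nat \<Rightarrow> real. strict_mono \<theta> \<and> (\<forall>n. 0 < \<theta> n) \<and> filterlim \<theta> at_top sequentially \<and>
        (\<forall>y\<in>K. AE t in lebesgue_on {0..}. (\<lambda>n. f (t + \<theta> n) y) \<longlonglongrightarrow> g t y)))"
proof -

  \<comment> \<open>Decomposition of the Bochner transform\<close>
  note p = assms(1)
  interpret Lp: seminormed_subgroup "Lp p :: 'x ae_fun set" "Lp_norm p"
    using p by (rule seminormed_subgroup_Lp)
  let ?N = "Lp_norm p :: 'x ae_fun \<Rightarrow> real"
  define F where "F = bochner_transform f"
  obtain G Q where G: "almost_periodic (Lp p) ?N {0..} G" and Q: "Q \<in> C0_halfline (Lp p) ?N"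
      and FGQ: "\<And>t y. 0 \<le> t \<Longrightarrow> F t y = G t y + Q t y"
    using assms(2) unfolding asymptotically_Sp_almost_periodic_def asymptotically_almost_periodic_def F_def
    by blast
  have GZ: "G t y \<in> Lp p" and QZ: "Q t y \<in> Lp p" if "0 \<le> t" for t y
    using that G Q by (auto simp: almost_periodic_def C0_halfline_def maps_continuously_def)
  then have FZ: "F t y \<in> Lp p" if "0 \<le> t" for t y
    using that FGQ Lp.add_mem by simp

  \<comment> \<open>Almost periods tending to infinity for each fixed \<open>y\<close>\<close>
  have "\<forall>y. \<exists>\<tau>. filterlim \<tau> at_top sequentially \<and> (\<forall>n. real n < \<tau> n) \<and>
      (\<forall>n. \<forall>t\<ge>0. ?N (G (t + \<tau> n) y - G t y) \<le> (1/4)^n) \<and>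
      (\<forall>n. \<forall>t\<ge>\<tau> n - real n. ?N (Q t y) \<le> (1/4)^n)" (is "\<forall>y. ?P y")
  proof
    fix y
    obtain \<tau> where "\<And>n. real n < \<tau> n"
        "\<And>n t z. 0 \<le> t \<Longrightarrow> z \<in> {y} \<Longrightarrow> ?N (G (t + \<tau> n) z - G t z) \<le> (1/4)^n"
        "\<And>n t z. \<tau> n - real n \<le> t \<Longrightarrow> z \<in> {y} \<Longrightarrow> ?N (Q t z) \<le> (1/4)^n"
      by (rule almost_period_sequence[OF G Q compact_sing]) blast
    moreover from this(1) have "filterlim \<tau> at_top sequentially"
      by (intro filterlim_at_top_mono[OF filterlim_real_sequentially] always_eventually) (auto intro: less_imp_le)
    ultimately show "?P y" by blast
  qed
  from choice[OF this] obtain \<tau> where \<tau>_top: "\<And>y. filterlim (\<tau> y) at_top sequentially"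
      and \<tau>: "\<And>y n. real n < \<tau> y n"
        "\<And>y n t. 0 \<le> t \<Longrightarrow> ?N (G (t + \<tau> y n) y - G t y) \<le> (1/4)^n"
        "\<And>y n t. \<tau> y n - real n \<le> t \<Longrightarrow> ?N (Q t y) \<le> (1/4)^n"
    by blast
  \<comment> \<open>Here \<open>F - G = Q\<close>. Already for \<open>t \<ge> - real n\<close> the
    translated time is nonnegative and lies where \<open>Q\<close> is small, so negative
    \<open>t\<close> are covered.\<close>
  have FG: "?N (F (t + \<tau> y n) y - G (t + \<tau> y n) y) \<le> (1/4)^n" if "0 \<le> t + real n" for t y n
  proof -
    have "0 \<le> t + \<tau> y n" "\<tau> y n - real n \<le> t + \<tau> y n"
      using that \<tau>(1)[of n y] by linarith+
    then show ?thesis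
      using \<tau>(3) by (simp add: FGQ)
  qed

  \<comment> \<open>The function \<open>g\<close> as a limit of translates of
    \<open>f\<close>\<close>
  define g where "g t y = lim (\<lambda>n. f (t + \<tau> y n) y)" for t y
  define H where "H = bochner_transform g"
  \<comment> \<open>A pointwise \<open>lim\<close> makes the choices on overlapping unit intervals
    agree automatically. Its value is unspecified where the translates diverge, which happens only
    on a null set of each interval.\<close>
  have g: "p_integrable_on p {0..1} (\<lambda>s. g (t + s) y) \<and> (\<lambda>n. ?N (F (t + \<tau> y n) y - H t y)) \<longlonglongrightarrow> 0"
    for t y
  proof -
    \<comment> \<open>For negative \<open>t\<close> the first translates may involve times outside
      the half-line; dropping \<open>k \<ge> - t\<close> terms avoids this and leaves the limit
      unchanged.\<close>
    define k where "k = nat \<lceil>- t\<rceil>"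
    have k: "0 \<le> t + real (n + k)" for n
      unfolding k_def by linarith
    define w where "w n s = f (t + \<tau> y (n + k) + s) y" for n s
    have w_F: "ae_class (w n) = F (t + \<tau> y (n + k)) y" for n
      by (simp add: w_def[abs_def] F_def bochner_transform_def)
    have nonneg: "0 \<le> t + \<tau> y (n + k)" for n
      using k[of n] \<tau>(1)[of "n + k" y] by linarith
    have w: "p_integrable_on p {0..1} (w n)" for n
      using FZ[OF nonneg] by (simp flip: ae_class_in_Lp_iff add: w_F)
    have Cauchy: "?N (ae_class (w m) - ae_class (w n)) \<le> 2 * ((1/4)^m + (1/4)^n)" for m n
    proof -
      let ?m = "t + \<tau> y (m + k)" and ?n = "t + \<tau> y (n + k)"
      \<comment> \<open>The time \<open>?mn\<close> is reached from \<open>?m\<close> and from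
        \<open>?n\<close> by one almost period each, so \<open>G\<close> at \<open>?mn\<close> links
        the two translates. All three times are nonnegative, as the almost periods of
        \<open>G\<close> require.\<close>
      let ?mn = "t + \<tau> y (m + k) + \<tau> y (n + k)"
      have mn: "0 \<le> ?mn"
        using nonneg[of m] \<tau>(1)[of "n + k" y] by linarith
      have decr: "(1/4)^(j + k) \<le> (1/4::real)^j" for j
        by (rule power_decreasing) auto
      have mem: "F ?m y \<in> Lp p" "F ?n y \<in> Lp p" "G ?m y \<in> Lp p" "G ?n y \<in> Lp p" "G ?mn y \<in> Lp p"
        using nonneg mn by (simp_all add: FZ GZ)
      have "?N (F ?m y - F ?n y)
          \<le> ?N (F ?m y - G ?m y) + ?N (G ?mn y - G ?m y) + ?N (G ?mn y - G ?n y) + ?N (F ?n y - G ?n y)"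
        using Lp.seminorm_diff_triangle[OF mem(1,3,2)] Lp.seminorm_diff_triangle[OF mem(3,5,2)]
          Lp.seminorm_diff_triangle[OF mem(5,4,2)]
          Lp.seminorm_diff_commute[of "G ?m y" "G ?mn y"] Lp.seminorm_diff_commute[of "G ?n y" "F ?n y"]
        by linarith
      also have "?N (F ?m y - G ?m y) \<le> (1/4)^(m + k)"
        by (rule FG) (rule k)
      also have "?N (F ?n y - G ?n y) \<le> (1/4)^(n + k)"
        by (rule FG) (rule k)
      also have "?N (G ?mn y - G ?m y) \<le> (1/4)^(n + k)"
        by (rule \<tau>(2)) (rule nonneg)
      also have "?N (G ?mn y - G ?n y) \<le> (1/4)^(m + k)"
        using \<tau>(2)[OF nonneg[of n], of y "m + k"] by (simp add: add_ac)
      also have "(1/4)^(m + k) + (1/4)^(n + k) + (1/4)^(m + k) + (1/4)^(n + k)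
          \<le> 2 * ((1/4)^m + (1/4::real)^n)"
        using add_mono[OF add_mono[OF decr[of m] decr[of n]] add_mono[OF decr[of m] decr[of n]]]
        by (simp only: add.assoc mult_2)
      finally show ?thesis
        by (simp add: w_F)
    qed
    have "AE s in lebesgue_on {0..1}. convergent (\<lambda>n. w n s)"
      by (rule Lp_Cauchy_convergent_AE[OF p _ w Cauchy]) simp
    then have lim: "AE s in lebesgue_on {0..1}. (\<lambda>n. w n s) \<longlonglongrightarrow> g (t + s) y"
    proof eventually_elim
      case (elim s)
      then obtain L where L: "(\<lambda>n. w n s) \<longlonglongrightarrow> L"
        unfolding convergent_def by blast
      then have "(\<lambda>n. f (t + s + \<tau> y n) y) \<longlonglongrightarrow> L"
        using LIMSEQ_offset[of "\<lambda>n. f (t + s + \<tau> y n) y" k L] by (simp add: w_def add_ac)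
      then have "g (t + s) y = L"
        unfolding g_def by (rule limI)
      with L show ?case by simp
    qed
    have H: "ae_class (\<lambda>s. g (t + s) y) = H t y"
      by (simp add: H_def bochner_transform_def)
    note limit = Lp_Cauchy_limit[OF p _ w Cauchy lim, simplified]
    have "(\<lambda>n. ?N (F (t + \<tau> y (n + k)) y - H t y)) \<longlonglongrightarrow> 0"
    proof (rule Lim_null_comparison)
      show "\<forall>\<^sub>F n in sequentially. norm (?N (F (t + \<tau> y (n + k)) y - H t y)) \<le> 4 * (1/4)^n"
        using limit(2) Lp.seminorm_nonneg by (simp add: w_F H)
      show "(\<lambda>n. 4 * (1/4::real)^n) \<longlonglongrightarrow> 0"
        by (intro tendsto_mult_right_zero LIMSEQ_power_zero) simp
    qed
    with limit(1) show ?thesis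
      using LIMSEQ_offset[of "\<lambda>n. ?N (F (t + \<tau> y n) y - H t y)" k 0] by blast
  qed

  \<comment> \<open>The transform of \<open>g\<close> as an almost periodic extension of
    \<open>G\<close>\<close>
  have HZ: "H t y \<in> Lp p" for t y
    using g by (simp add: H_def bochner_transform_def ae_class_in_Lp_iff)
  have late: "\<forall>\<^sub>F n in sequentially. 0 \<le> t + real n" for t
    using eventually_ge_at_top[of "nat \<lceil>- t\<rceil>"] by eventually_elim linarith
  have late': "\<forall>\<^sub>F n in sequentially. 0 \<le> t + \<tau> y n" for t y
    using late[of t] by eventually_elim (use \<tau>(1) in \<open>smt (verit)\<close>)
  have GH: "(\<lambda>n. ?N (G (t + \<tau> y n) y - H t y)) \<longlonglongrightarrow> 0" for t y
  proof (rule Lim_null_comparison)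
    show "\<forall>\<^sub>F n in sequentially. norm (?N (G (t + \<tau> y n) y - H t y))
        \<le> (1/4)^n + ?N (F (t + \<tau> y n) y - H t y)"
      using late[of t] late'[of t y]
    proof eventually_elim
      case (elim n)
      then show ?case
        using Lp.seminorm_diff_triangle[OF GZ[OF elim(2), of y] FZ[OF elim(2), of y] HZ[of t y]]
          Lp.seminorm_diff_commute[of "G (t + \<tau> y n) y" "F (t + \<tau> y n) y"] FG[OF elim(1), of y]
          Lp.seminorm_nonneg
        by simp
    qed
    show "(\<lambda>n. (1/4)^n + ?N (F (t + \<tau> y n) y - H t y)) \<longlonglongrightarrow> 0"
      using tendsto_add[OF LIMSEQ_power_zero[of "1/4::real"] conjunct2[OF g]] by simp
  qed
  \<comment> \<open>For \<open>t \<ge> 0\<close> both sides are limits of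
    \<open>G (t + \<tau> y n) y\<close>. Their difference has norm zero and is therefore zero in the
    quotient by almost everywhere equality.\<close>
  have HG: "H t y = G t y" if "0 \<le> t" for t y
  proof -
    have "(\<lambda>n. ?N (G (t + \<tau> y n) y - G t y)) \<longlonglongrightarrow> 0"
    proof (rule Lim_null_comparison)
      show "\<forall>\<^sub>F n in sequentially. norm (?N (G (t + \<tau> y n) y - G t y)) \<le> (1/4)^n"
        using \<tau>(2)[OF that] Lp.seminorm_nonneg by simp
    qed (simp add: LIMSEQ_power_zero)
    moreover have "\<forall>\<^sub>F n in sequentially. G (t + \<tau> y n) y \<in> Lp p"
      using late' by eventually_elim (rule GZ)
    ultimately have "?N (H t y - G t y) = 0"
      using GH by (intro Lp.seminorm_limits_eq[OF HZ GZ[OF that]])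
    then show ?thesis
      using Lp_norm_eq_0_imp[OF p Lp.diff_mem[OF HZ GZ[OF that]]] by simp
  qed
  have H_ap: "almost_periodic (Lp p) ?N UNIV H"
  proof (rule Lp.almost_periodic_extend[OF G HZ HG])
    fix y
    show "\<exists>\<sigma>. filterlim \<sigma> at_top sequentially \<and> (\<forall>t. (\<lambda>n. ?N (H t y - G (t + \<sigma> n) y)) \<longlonglongrightarrow> 0)"
      using \<tau>_top[of y] GH[of _ y] by (subst Lp.seminorm_diff_commute) blast
  qed

  \<comment> \<open>The remainder \<open>q\<close>\<close>
  define q where "q t y = f t y - g t y" for t y
  \<comment> \<open>Since \<open>q\<close> is the pointwise difference, \<open>f = g + q\<close>
    holds at every time and not just almost everywhere; only the transform has to be identified, and
    only from time zero on.\<close>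
  have qQ: "bochner_transform q t y = Q t y" if "0 \<le> t" for t y
  proof -
    have "bochner_transform q t y = F t y - H t y"
      by (simp add: bochner_transform_def F_def H_def q_def minus_ae_fun.abs_eq)
    then show ?thesis
      by (simp add: FGQ[OF that] HG[OF that])
  qed
  have q_C0: "bochner_transform q \<in> C0_halfline (Lp p) ?N"
    unfolding C0_halfline_def
  proof (intro CollectI conjI allI impI)
    show "maps_continuously (Lp p) ?N {0..} (bochner_transform q)"
      using Q by (simp add: C0_halfline_def maps_continuously_def qQ)
  next
    fix K :: "'y set" assume "compact K"
    then have "uniform_limit K (\<lambda>t y. ?N (Q t y)) (\<lambda>_. 0) at_top"
      using Q by (simp add: C0_halfline_def)
    moreover have "\<forall>\<^sub>F t in at_top. \<forall>y\<in>K. ?N (Q t y) = ?N (bochner_transform q t y)"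
      using eventually_ge_at_top[of 0] by eventually_elim (simp add: qQ)
    ultimately show "uniform_limit K (\<lambda>t y. ?N (bochner_transform q t y)) (\<lambda>_. 0) at_top"
      by (subst (asm) uniform_limit_cong) simp_all
  qed
  have g_loc: "locally_p_integrable_on p UNIV (\<lambda>t. g t y)" for y
    using g by (intro locally_p_integrable_on_UNIV_I[OF p]) blast
  have q_loc: "locally_p_integrable_on p {0..} (\<lambda>t. q t y)" for y
    using assms(2) g_loc[of y] p_integrable_on_diff[OF p]
    unfolding asymptotically_Sp_almost_periodic_def locally_p_integrable_on_def q_def by blast

  \<comment> \<open>Translation sequences common to a compact set\<close>
  have "\<exists>\<theta> :: nat \<Rightarrow> real. strict_mono \<theta> \<and> (\<forall>n. 0 < \<theta> n) \<and> filterlim \<theta> at_top sequentially \<and>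
      (\<forall>y\<in>K. AE t in lebesgue_on {0..}. (\<lambda>n. f (t + \<theta> n) y) \<longlonglongrightarrow> g t y)" if "compact K" for K
  proof -
    obtain \<theta> :: "nat \<Rightarrow> real" where \<theta>: "strict_mono \<theta>" "\<And>n. real n < \<theta> n"
        "\<And>n t y. 0 \<le> t \<Longrightarrow> y \<in> K \<Longrightarrow> ?N (G (t + \<theta> n) y - G t y) \<le> (1/4)^n"
        "\<And>n t y. \<theta> n - real n \<le> t \<Longrightarrow> y \<in> K \<Longrightarrow> ?N (Q t y) \<le> (1/4)^n"
      by (rule almost_period_sequence[OF G Q \<open>compact K\<close>]) (rule that)
    have pos: "0 < \<theta> n" for n
      using \<theta>(2)[of n] by linarith
    have "filterlim \<theta> at_top sequentially"
      using \<theta>(2) by (intro filterlim_at_top_mono[OF filterlim_real_sequentially] always_eventually)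
        (auto intro: less_imp_le)
    moreover have "AE t in lebesgue_on {0..}. (\<lambda>n. f (t + \<theta> n) y) \<longlonglongrightarrow> g t y" if y: "y \<in> K" for y
    proof (rule AE_lebesgue_on_halfline)
      fix k :: nat
      let ?v = "\<lambda>n s. f (real k + \<theta> n + s) y - g (real k + s) y"
      have k: "0 \<le> real k + \<theta> n" for n
        using pos[of n] by simp
      have f_int: "p_integrable_on p {0..1} (\<lambda>s. f (real k + \<theta> n + s) y)" for n
        using FZ[OF k] by (simp add: F_def bochner_transform_def ae_class_in_Lp_iff)
      \<comment> \<open>Although \<open>g\<close> was built from sequences depending on
        \<open>y\<close>, its transform equals \<open>G\<close> on the half-line, so almost periods
        uniform over \<open>K\<close> serve all \<open>y \<in> K\<close> together.\<close>
      have "?N (F (real k + \<theta> n) y - H (real k) y) \<le> 2 * (1/4)^n" for n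
      proof -
        have "F (real k + \<theta> n) y - H (real k) y
            = (G (real k + \<theta> n) y - G (real k) y) + Q (real k + \<theta> n) y"
          using k by (simp add: FGQ HG)
        also have "?N \<dots> \<le> ?N (G (real k + \<theta> n) y - G (real k) y) + ?N (Q (real k + \<theta> n) y)"
          using k by (intro Lp.seminorm_add_le Lp.diff_mem GZ QZ) auto
        also have "\<dots> \<le> (1/4)^n + (1/4)^n"
          using y by (intro add_mono \<theta>(3,4)) auto
        finally show ?thesis by simp
      qed
      then have le: "Lp_integral p (lebesgue_on {0..1}) (?v n) \<le> ennreal ((2 * (1/4)^n) powr p)" for n
        using f_int conjunct1[OF g] by (intro Lp_integral_diff_le[OF p])
          (simp_all add: F_def H_def bochner_transform_def)
      \<comment> \<open>The geometric rate yields convergence of the whole sequence. Mere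
        \<open>Lp\<close> convergence would only give a subsequence, which could depend on
        \<open>y\<close>.\<close>
      have "AE s in lebesgue_on {0..1}. (\<lambda>n. 2^n * norm (?v n s)) \<longlonglongrightarrow> 0"
        by (rule Lp_geometric_decay_tendsto_AE[OF p _ _ le])
          (use p_integrable_on_diff[OF p f_int conjunct1[OF g]] in \<open>simp_all add: p_integrable_on_def\<close>)
      then show "AE s in lebesgue_on {0..1}. (\<lambda>n. f (real k + s + \<theta> n) y) \<longlonglongrightarrow> g (real k + s) y"
      proof eventually_elim
        case (elim s)
        have "norm (?v n s) \<le> 2^n * norm (?v n s)" for n
          using mult_right_mono[of 1 "2^n" "norm (?v n s)"] by simp
        then have "(\<lambda>n. ?v n s) \<longlonglongrightarrow> 0"
          by (intro Lim_null_comparison[OF _ elim] always_eventually) blast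
        from tendsto_add[OF this tendsto_const[of "g (real k + s) y"]] show ?case
          by (simp add: add_ac)
      qed
    qed
    ultimately show ?thesis
      using \<theta>(1) pos by blast
  qed
  with g_loc q_loc H_ap q_C0 show ?thesis
    by (intro exI[of _ g] exI[of _ q]) (simp add: H_def q_def)
qed

end
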